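(* Assume $\boldsymbol{\rho}(\mathbf{X})<+\infty$. Let $F\in L^1(\Omega)$. Then $\mathcal{H}F\in \mathbb{L}^1_{\mathcal{P}}$ and $$F = F(\boldsymbol{\omega}_\emptyset) + \int_{[0,T]\times\mathbb{X}} \mathcal{H}_{(t,x)}F\; \mathbf{N}(dt,dx),\quad \mathbb{P}\text{-a.s.}$$ In addition this decomposition is unique in the following sense: if there exists $(c,Z)\in\mathbb{R}\times\mathbb{L}^1_{\mathcal{P}}$ such that $$F = c+\int_{[0,T]\times\mathbb{X}} Z_{(t,x)}\;\mathbf{N}(dt,dx),\quad \mathbb{P}\text{-a.s.},$$ then $c=F(\boldsymbol{\omega}_\emptyset)$ and, for a.e. $(t,x)\in[0,T]\times\mathbb{X}$, $Z_{(t,x)}=\mathcal{H}_{(t,x)}F$, $\mathbb{P}$-a.s.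
   Context: Setting. $(\mathbb{X},\mathcal{X})$ is a complete separable metric space (with its Borel $\sigma$-field) equipped with a non-atomic $\sigma$-finite measure $\pi$; $T>0$ is a fixed real number; $\mathbf{X}:=[0,T]\times\mathbb{X}$ with $\sigma$-field $\mathfrak{X}:=\mathcal{B}([0,T])\otimes\mathcal{X}$ and measure $\boldsymbol{\rho}:=dt\otimes\pi$ ($dt$ Lebesgue measure). Poisson space. $\Omega:=\{\boldsymbol{\omega}=\sum_{j=1}^n\delta_{\mathbf{x}_j}:\ \mathbf{x}_j\in\mathbf{X},\ n\in\mathbb{N}\cup\{+\infty\}\}$ is the space of configurations on $\mathbf{X}$, with the $\sigma$-field associated with the vague topology; $\boldsymbol{\omega}_\emptyset$ is the empty configuration (zero measure). $\mathbb{P}$ is the probability on $\Omega$ under which the canonical evaluation $(\mathbf{N}(\boldsymbol{\omega}))(A):=\boldsymbol{\omega}(A)$ is a Poisson random measure with intensity measure $\boldsymbol{\rho}$. Set $\mathcal{F}^{\mathbf{N}}_t:=\sigma\{\mathbf{N}(A\times B): A\times B\in\mathfrak{X},\ A\subset[0,t]\}$ and $\mathcal{F}^{\mathbf{N}}:=\sigma\{\mathbf{N}(A\times B): A\times B\in\mathfrak{X}\}$. $L^0(\Omega)$ is the set of $\mathcal{F}^{\mathbf{N}}$-measurable $F:\Omega\to\mathbb{R}$, and $L^r(\Omega):=\{F\in L^0(\Omega):\mathbb{E}[|F|^r]<+\infty\}$. Predictable processes. $\mathcal{P}:=\mathcal{P}^{\mathbf{N}}\otimes\mathcal{B}(\mathbb{X})$,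 where $\mathcal{P}^{\mathbf{N}}$ is the $\sigma$-field on $[0,T]\times\Omega$ generated by the left-continuous $(\mathcal{F}^{\mathbf{N}}_t)$-adapted processes. For $r>0$, $\mathbb{L}^r_{\mathcal{P}}$ is the set of $\mathcal{P}$-measurable $X:\Omega\times[0,T]\times\mathbb{X}\to\mathbb{R}$ with $\mathbb{E}\big[\int_{[0,T]\times\mathbb{X}}|X_{(t,x)}|^r\,dt\,\pi(dx)\big]<+\infty$. Operators. For $F\in L^0(\Omega)$ and $\mathbf{x}\in\mathbf{X}$, the Malliavin derivative is $\mathbf{D}_{\mathbf{x}}F(\boldsymbol{\omega}):=F(\boldsymbol{\omega}+\delta_{\mathbf{x}}\mathbf{1}_{\{\boldsymbol{\omega}(\{\mathbf{x}\})=0\}})-F(\boldsymbol{\omega})$. For $t>0$, $\tau_t:\Omega\to\Omega$ maps $\boldsymbol{\omega}=\sum_{j=1}^n\delta_{(t_j,x_j)}$ to $\boldsymbol{\omega}_t:=\sum_{j=1}^n\delta_{(t_j,x_j)}\mathbf{1}_{\{t_j<t\}}$, and $\tau_0(\boldsymbol{\omega}):=\boldsymbol{\omega}_\emptyset$. The operator $\mathcal{H}:L^0(\Omega)\to L^0(\Omega\times\mathbf{X})$ is $\mathcal{H}_{(t,x)}F:=(\mathbf{D}_{(t,x)}F)\circ\tau_t$, i.e. $\mathcal{H}_{(t,x)}F(\boldsymbol{\omega})=F(\boldsymbol{\omega}_t+\delta_{(t,x)})-F(\boldsymbol{\omega}_t)$. *)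

theory Defs
  imports "HOL-Probability.Probability"
begin

definition nonatomic :: "'a measure \<Rightarrow> bool" where
  "nonatomic M \<longleftrightarrow>
     \<not> (\<exists>A\<in>sets M. 0 < emeasure M A \<and>
          (\<forall>B\<in>sets M. B \<subseteq> A \<longrightarrow> emeasure M B < emeasure M A \<longrightarrow> emeasure M B = 0))"

text \<open>\<open>N\<close> is a Poisson random measure on \<open>M\<close> with intensity \<open>M\<close>, defined on the probability
  space \<open>P\<close>. As usual, a Poisson variable with infinite mean is almost surely infinite.
  Independence over finite families of disjoint sets is included: pad with empty sets.\<close>

definition poisson_random_measure ::
    "'w measure \<Rightarrow> 'x measure \<Rightarrow> ('w \<Rightarrow> 'x measure) \<Rightarrow> bool" where
  "poisson_random_measure P M N \<longleftrightarrow>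
     prob_space P \<and>
     (\<forall>w\<in>space P. sets (N w) = sets M) \<and>
     (\<forall>A\<in>sets M. (\<lambda>w. emeasure (N w) A) \<in> borel_measurable P) \<and>
     (\<forall>A\<in>sets M. emeasure M A < \<infinity> \<longrightarrow>
        (\<forall>k::nat. measure P {w\<in>space P. emeasure (N w) A = of_nat k} =
           exp (- measure M A) * measure M A ^ k / fact k)) \<and>
     (\<forall>A\<in>sets M. emeasure M A = \<infinity> \<longrightarrow> (AE w in P. emeasure (N w) A = \<infinity>)) \<and>
     (\<forall>A::nat \<Rightarrow> 'x set. range A \<subseteq> sets M \<longrightarrow> disjoint_family A \<longrightarrow>
        prob_space.indep_vars P (\<lambda>_. borel) (\<lambda>i w. emeasure (N w) (A i)) UNIV)"

text \<open>The measurable space \<open>[0,T] \<times> \<X>\<close>, where \<open>\<X>\<close> is the type \<open>'a\<close>. Only its space and its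
  sigma-field are used; the intensity measure is \<open>rho\<close>.\<close>

definition phase :: "real \<Rightarrow> (real \<times> 'a::polish_space) measure" where
  "phase T = restrict_space borel {0..T} \<Otimes>\<^sub>M borel"

definition rho :: "real \<Rightarrow> 'a::polish_space measure \<Rightarrow> (real \<times> 'a) measure" where
  "rho T \<pi> = restrict_space lborel {0..T} \<Otimes>\<^sub>M \<pi>"

text \<open>The image of counting measure on \<open>{j. j < n}\<close> under \<open>x\<close> is the sum of the Dirac measures
  at the points \<open>x j\<close>, \<open>j < n\<close>. The case \<open>n = \<infinity>\<close> is allowed, and points may be repeated.\<close>

definition configs :: "real \<Rightarrow> (real \<times> 'a::polish_space) measure set" where
  "configs T = {distr (count_space {j::nat. enat j < n}) (phase T) x | (n::enat) x.
                  \<forall>j. enat j < n \<longrightarrow> x j \<in> space (phase T)}"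

abbreviation empty_config :: "real \<Rightarrow> (real \<times> 'a::polish_space) measure" where
  "empty_config T \<equiv> null_measure (phase T)"

text \<open>The sigma-field associated with the vague topology, i.e. the one generated by all the
  evaluations \<open>\<omega> \<mapsto> \<omega>(E)\<close>.\<close>

definition config_space :: "real \<Rightarrow> (real \<times> 'a::polish_space) measure measure" where
  "config_space T = sigma (configs T)
     {{\<omega>\<in>configs T. emeasure \<omega> E \<in> U} | E U. E \<in> sets (phase T) \<and> U \<in> sets borel}"

text \<open>\<open>poisson_law T \<pi> P\<close>: the canonical evaluation \<open>N(\<omega>) = \<omega>\<close> is, under \<open>P\<close>, a Poisson random
  measure with intensity \<open>rho T \<pi>\<close>.\<close>

definition poisson_law ::
    "real \<Rightarrow> 'a::polish_space measure \<Rightarrow> (real \<times> 'a) measure measure \<Rightarrow> bool" where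
  "poisson_law T \<pi> P \<longleftrightarrow>
     space P = configs T \<and> sets P = sets (config_space T) \<and>
     poisson_random_measure P (rho T \<pi>) (\<lambda>\<omega>. \<omega>)"

definition FN_upto :: "real \<Rightarrow> real \<Rightarrow> (real \<times> 'a::polish_space) measure measure" where
  "FN_upto T t = sigma (configs T)
     {{\<omega>\<in>configs T. emeasure \<omega> (A \<times> B) \<in> U} | A B U.
        A \<times> B \<in> sets (phase T) \<and> A \<subseteq> {0..t} \<and> U \<in> sets borel}"

definition FN :: "real \<Rightarrow> (real \<times> 'a::polish_space) measure measure" where
  "FN T = sigma (configs T)
     {{\<omega>\<in>configs T. emeasure \<omega> (A \<times> B) \<in> U} | A B U.
        A \<times> B \<in> sets (phase T) \<and> U \<in> sets borel}"

text \<open>Random variables and processes are total functions; only their values on \<open>configs T\<close>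
  and on \<open>space (phase T)\<close> matter.\<close>

definition L0 :: "real \<Rightarrow> ((real \<times> 'a::polish_space) measure \<Rightarrow> real) set" where
  "L0 T = borel_measurable (FN T)"

definition Lr :: "real \<Rightarrow> (real \<times> 'a::polish_space) measure measure \<Rightarrow> real \<Rightarrow>
    ((real \<times> 'a) measure \<Rightarrow> real) set" where
  "Lr T P r = {F \<in> L0 T. (\<integral>\<^sup>+\<omega>. ennreal (\<bar>F \<omega>\<bar> powr r) \<partial>P) < \<infinity>}"

definition left_cont_adapted ::
    "real \<Rightarrow> (real \<Rightarrow> (real \<times> 'a::polish_space) measure \<Rightarrow> real) \<Rightarrow> bool" where
  "left_cont_adapted T Y \<longleftrightarrow>
     (\<forall>t\<in>{0..T}. Y t \<in> borel_measurable (FN_upto T t)) \<and>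
     (\<forall>\<omega>\<in>configs T. \<forall>t\<in>{0<..T}. continuous (at_left t) (\<lambda>s. Y s \<omega>))"

definition predictable_N :: "real \<Rightarrow> (real \<times> (real \<times> 'a::polish_space) measure) measure" where
  "predictable_N T = sigma ({0..T} \<times> configs T)
     {{(t, \<omega>). t \<in> {0..T} \<and> \<omega> \<in> configs T \<and> Y t \<omega> \<in> U} | Y U.
        left_cont_adapted T Y \<and> U \<in> sets borel}"

definition predictable ::
    "real \<Rightarrow> ((real \<times> (real \<times> 'a::polish_space) measure) \<times> 'a) measure" where
  "predictable T = predictable_N T \<Otimes>\<^sub>M borel"

text \<open>A process is written as \<open>Z (t, x) \<omega>\<close>.\<close>

definition LrP :: "real \<Rightarrow> 'a::polish_space measure \<Rightarrow> (real \<times> 'a) measure measure \<Rightarrow> real \<Rightarrow>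
    (real \<times> 'a \<Rightarrow> (real \<times> 'a) measure \<Rightarrow> real) set" where
  "LrP T \<pi> P r = {Z. (\<lambda>((t, \<omega>), x). Z (t, x) \<omega>) \<in> borel_measurable (predictable T) \<and>
     (\<integral>\<^sup>+\<omega>. (\<integral>\<^sup>+p. ennreal (\<bar>Z p \<omega>\<bar> powr r) \<partial>rho T \<pi>) \<partial>P) < \<infinity>}"

text \<open>The measure \<open>\<omega> + \<delta>\<^sub>p\<close>.\<close>

definition add_dirac :: "'x measure \<Rightarrow> 'x \<Rightarrow> 'x measure" where
  "add_dirac \<omega> p = measure_of (space \<omega>) (sets \<omega>) (\<lambda>A. emeasure \<omega> A + indicator A p)"

definition malliavin_D :: "'x \<Rightarrow> ('x measure \<Rightarrow> real) \<Rightarrow> 'x measure \<Rightarrow> real" where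
  "malliavin_D p F \<omega> = F (if emeasure \<omega> {p} = 0 then add_dirac \<omega> p else \<omega>) - F \<omega>"

text \<open>The restriction of \<open>\<omega>\<close> to the points with time coordinate smaller than \<open>t\<close>.\<close>

definition tau :: "real \<Rightarrow> (real \<times> 'a) measure \<Rightarrow> (real \<times> 'a) measure" where
  "tau t \<omega> = (if t = 0 then null_measure \<omega> else density \<omega> (indicator ({..<t} \<times> UNIV)))"

definition op_H :: "real \<times> 'a \<Rightarrow> ((real \<times> 'a) measure \<Rightarrow> real) \<Rightarrow> (real \<times> 'a) measure \<Rightarrow> real" where
  "op_H p F = malliavin_D p F \<circ> tau (fst p)"

end

theory Submission
  imports Defs "HOL-Real_Asymp.Real_Asymp"
begin

text \<open>
  Almost every configuration is finite with pairwise distinct times. Listing its points in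
  increasing time, the increments \<open>op_H p F \<omega>\<close> telescope to \<open>F \<omega> - F (empty_config T)\<close>.
  Conversely, a predictable \<open>Z\<close> at time \<open>t > 0\<close> sees only the points before \<open>t\<close>, so the operator
  \<open>op_H p\<close> recovers \<open>Z p\<close> from \<open>\<omega> \<mapsto> c + (\<integral>p. Z p \<omega> \<partial>\<omega>)\<close> pathwise. What remains is that
  \<open>op_H\<close> respects null sets and integrability: the laws of \<open>tau t \<omega>\<close> under \<open>P\<close> and of
  \<open>tau t \<omega> + \<delta>\<^sub>p\<close>, \<open>p = (t, x)\<close>, under \<open>rho T \<pi> \<otimes> P\<close> are dominated by \<open>P\<close> up to the factor
  \<open>exp (\<rho> (space \<rho>))\<close>. Both laws are identified by their void probabilities, so that no
  independence property of the Poisson measure is needed.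
\<close>

section \<open>Configurations\<close>

text \<open>An almost sure identity for \<open>F\<close> says nothing directly about
  \<open>op_H p F\<close>, which evaluates \<open>F\<close> at \<open>tau t \<omega>\<close> and at
  the same configuration with \<open>p\<close> added; neither is distributed according to
  \<open>P\<close>. The obvious tool for adding a point, the Mecke formula, would compare with the
  expectation of |F| times the number of points, which may be infinite for an integrable
  \<open>F\<close>. The operator, however, adds \<open>p\<close> after all points kept by
  \<open>tau\<close>, so \<open>p\<close> is the last point of the new configuration. A nonempty
  configuration with distinct times thus arises once, from its last point, and not once from each of
  its points, so no factor counting the points appears. The price is the probability
  \<open>exp (- measure \<rho> (late t))\<close> that nothing else follows; it is at least
  \<open>exp (- R)\<close>, where \<open>R\<close> is the total intensity, and this is the origin of
  the factor.\<close>

lemma space_phase: "space (phase T) = {0..T} \<times> UNIV"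
  by (simp add: phase_def space_pair_measure space_restrict_space)

lemma early_sets: "({..<t} \<times> UNIV) \<inter> space (phase T) \<in> sets (phase T)"
proof -
  have "({..<t} \<inter> {0..T}) \<times> UNIV \<in> sets (phase T)"
    unfolding phase_def by (intro pair_measureI) (auto simp: sets_restrict_space)
  moreover have "({..<t} \<inter> {0..T}) \<times> UNIV = ({..<t} \<times> UNIV) \<inter> space (phase T)"
    by (auto simp: space_phase)
  ultimately show ?thesis by metis
qed

lemma early_Int_sets: "E \<in> sets (phase T) \<Longrightarrow> E \<inter> ({..<t} \<times> UNIV) \<in> sets (phase T)"
proof -
  assume E: "E \<in> sets (phase T)"
  have "E \<inter> ({..<t} \<times> UNIV) = E \<inter> (({..<t} \<times> UNIV) \<inter> space (phase T))"
    using sets.sets_into_space[OF E] by auto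
  then show ?thesis using sets.Int[OF E early_sets] by (rule ssubst)
qed

lemma measurable_fst_phase [measurable]: "fst \<in> borel_measurable (phase T)"
  unfolding phase_def
  by (rule measurable_compose[OF measurable_fst]) (simp add: measurable_restrict_space1)

text \<open>Index sets are arbitrary sets of naturals and not only initial segments, so that
  forgetting points or adding one merely changes \<open>J\<close>. Repeated points carry distinct
  indices.\<close>

definition cfg :: "real \<Rightarrow> nat set \<Rightarrow> (nat \<Rightarrow> real \<times> 'a::polish_space) \<Rightarrow> (real \<times> 'a) measure" where
  "cfg T J x = distr (count_space J) (phase T) x"

lemma sets_cfg [simp]: "sets (cfg T J x) = sets (phase T)"
  and space_cfg [simp]: "space (cfg T J x) = space (phase T)"
  by (simp_all add: cfg_def)

lemma emeasure_cfg:
  assumes "x \<in> J \<rightarrow> space (phase T)" "E \<in> sets (phase T)"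
  shows "emeasure (cfg T J x) E = emeasure (count_space J) {j\<in>J. x j \<in> E}"
proof -
  have "x -` E \<inter> J = {j\<in>J. x j \<in> E}" by auto
  then show ?thesis
    unfolding cfg_def using assms by (simp add: emeasure_distr)
qed

text \<open>Any set of naturals is in bijection with an initial segment, of length
  \<open>card J\<close> or infinite, and a bijection preserves counting measure.\<close>

lemma configs_iff:
  "\<omega> \<in> configs T \<longleftrightarrow> (\<exists>J x. x \<in> J \<rightarrow> space (phase T) \<and> \<omega> = cfg T J x)"
proof
  assume "\<omega> \<in> configs T"
  then obtain n :: enat and x where n: "\<omega> = distr (count_space {j. enat j < n}) (phase T) x"
    "\<forall>j. enat j < n \<longrightarrow> x j \<in> space (phase T)"
    unfolding configs_def by blast
  show "\<exists>J x. x \<in> J \<rightarrow> space (phase T) \<and> \<omega> = cfg T J x"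
    by (rule exI[of _ "{j. enat j < n}"], rule exI[of _ x]) (use n in \<open>simp add: cfg_def Pi_iff\<close>)
next
  assume "\<exists>J x. x \<in> J \<rightarrow> space (phase T) \<and> \<omega> = cfg T J x"
  then obtain J x where J: "x \<in> J \<rightarrow> space (phase T)" "\<omega> = cfg T J x" by blast
  obtain n :: enat and f where f: "bij_betw f {j. enat j < n} J"
  proof (cases "finite J")
    case True
    then obtain h where "bij_betw h {0..<card J} J" using ex_bij_betw_nat_finite by blast
    moreover have "{0..<card J} = {j. enat j < enat (card J)}" by auto
    ultimately show ?thesis using that by metis
  next
    case False
    then have "bij_betw (enumerate J) UNIV J" by (rule bij_enumerate)
    moreover have "UNIV = {j. enat j < \<infinity>}" by auto
    ultimately show ?thesis using that by metis
  qed
  have xf: "x \<circ> f \<in> {j. enat j < n} \<rightarrow> space (phase T)"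
    using J(1) bij_betwE[OF f] by auto
  have "\<omega> = distr (distr (count_space {j. enat j < n}) (count_space J) f) (phase T) x"
    by (simp add: J cfg_def distr_bij_count_space[OF f])
  also have "\<dots> = distr (count_space {j. enat j < n}) (phase T) (x \<circ> f)"
    using J(1) bij_betwE[OF f] by (intro distr_distr) auto
  finally show "\<omega> \<in> configs T"
    unfolding configs_def using xf
    by (intro CollectI exI[of _ n] exI[of _ "x \<circ> f"] conjI) (simp_all add: Pi_iff)
qed

lemma cfg_in_configs: "x \<in> J \<rightarrow> space (phase T) \<Longrightarrow> cfg T J x \<in> configs T"
  using configs_iff by blast

lemma configs_cases:
  assumes "\<omega> \<in> configs T"
  obtains J x where "x \<in> J \<rightarrow> space (phase T)" "\<omega> = cfg T J x"
  using assms configs_iff by blast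

lemma sets_configs: "\<omega> \<in> configs T \<Longrightarrow> sets \<omega> = sets (phase T)"
  and space_configs: "\<omega> \<in> configs T \<Longrightarrow> space \<omega> = space (phase T)"
  by (auto elim!: configs_cases)

lemma configs_eqI:
  assumes "\<omega> \<in> configs T" "sets \<eta> = sets (phase T)"
    "\<And>E. E \<in> sets (phase T) \<Longrightarrow> emeasure \<omega> E = emeasure \<eta> E"
  shows "\<omega> = \<eta>"
  using assms by (intro measure_eqI) (auto simp: sets_configs)

text \<open>Configurations are integer-valued, so no mass lies strictly between 0 and 1. This later
  bounds the number of slices that are hit by the number of points.\<close>

lemma configs_ge_1:
  assumes "\<omega> \<in> configs T" "E \<in> sets (phase T)" "emeasure \<omega> E \<noteq> 0"
  shows "1 \<le> emeasure \<omega> E"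
proof -
  obtain J x where J: "x \<in> J \<rightarrow> space (phase T)" "\<omega> = cfg T J x"
    using assms(1) by (rule configs_cases)
  obtain k where "k \<in> J" "x k \<in> E"
    using assms J emeasure_cfg[of x J T E] by (cases "{j\<in>J. x j \<in> E} = {}") auto
  then have "emeasure (count_space J) {k} \<le> emeasure (count_space J) {j\<in>J. x j \<in> E}"
    by (intro emeasure_mono) auto
  then show ?thesis
    using \<open>k \<in> J\<close> J assms by (simp add: emeasure_cfg)
qed

section \<open>Adding a point and forgetting the future\<close>

lemma emeasure_add_dirac:
  assumes "A \<in> sets \<omega>"
  shows "emeasure (add_dirac \<omega> p) A = emeasure \<omega> A + indicator A p"
  unfolding add_dirac_def
proof (rule emeasure_measure_of_sigma)
  show "sigma_algebra (space \<omega>) (sets \<omega>)" by (rule sets.sigma_algebra_axioms)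
  show "positive (sets \<omega>) (\<lambda>A. emeasure \<omega> A + indicator A p)"
    by (simp add: positive_def)
  show "countably_additive (sets \<omega>) (\<lambda>A. emeasure \<omega> A + indicator A p)"
  proof (rule countably_additiveI)
    fix B :: "nat \<Rightarrow> _" assume B: "range B \<subseteq> sets \<omega>" "disjoint_family B" "\<Union> (range B) \<in> sets \<omega>"
    have "(\<Sum>i. emeasure \<omega> (B i) + indicator (B i) p) = (\<Sum>i. emeasure \<omega> (B i)) + (\<Sum>i. indicator (B i) p)"
      by (intro suminf_add[symmetric]) auto
    also have "\<dots> = emeasure \<omega> (\<Union> (range B)) + indicator (\<Union> (range B)) p"
      using B suminf_indicator[OF B(2), of p] by (simp add: suminf_emeasure)
    finally show "(\<Sum>i. emeasure \<omega> (B i) + indicator (B i) p) = emeasure \<omega> (\<Union> (range B)) + indicator (\<Union> (range B)) p" .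
  qed
qed (use assms in auto)

lemma sets_add_dirac [simp]: "sets (add_dirac \<omega> p) = sets \<omega>"
  by (simp add: add_dirac_def)

lemma sets_tau [simp]: "sets (tau t \<omega>) = sets \<omega>"
  by (simp add: tau_def)

lemma emeasure_tau:
  assumes "\<omega> \<in> configs T" "0 \<le> t" "E \<in> sets (phase T)"
  shows "emeasure (tau t \<omega>) E = emeasure \<omega> (E \<inter> ({..<t} \<times> UNIV))"
proof (cases "t = 0")
  case True
  \<comment> \<open>Times in the phase space are nonnegative, so nothing lies before 0 and the
    separate clause of \<open>tau\<close> at 0 agrees with the general formula.\<close>
  have "E \<inter> ({..<t} \<times> UNIV) = {}"
    using sets.sets_into_space[OF assms(3)] True by (auto simp: space_phase)
  then show ?thesis by (simp add: tau_def True)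
next
  case False
  have "(indicator ({..<t} \<times> UNIV) :: _ \<Rightarrow> ennreal) \<in> borel_measurable \<omega>"
    using assms(1) early_sets[of t T]
    by (subst borel_measurable_indicator_iff) (auto simp: space_configs sets_configs)
  then have "emeasure (tau t \<omega>) E = (\<integral>\<^sup>+p. indicator ({..<t} \<times> UNIV) p * indicator E p \<partial>\<omega>)"
    using False assms by (simp add: tau_def emeasure_density sets_configs)
  also have "\<dots> = (\<integral>\<^sup>+p. indicator (E \<inter> ({..<t} \<times> UNIV)) p \<partial>\<omega>)"
    by (intro nn_integral_cong) (auto split: split_indicator)
  also have "\<dots> = emeasure \<omega> (E \<inter> ({..<t} \<times> UNIV))"
    using assms early_Int_sets by (intro nn_integral_indicator) (simp add: sets_configs)
  finally show ?thesis .
qed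

lemma tau_cfg:
  assumes "x \<in> J \<rightarrow> space (phase T)" "0 \<le> t"
  shows "tau t (cfg T J x) = cfg T {j\<in>J. fst (x j) < t} x"
proof (rule configs_eqI[symmetric])
  let ?J = "{j\<in>J. fst (x j) < t}"
  show "cfg T ?J x \<in> configs T" using assms by (intro cfg_in_configs) auto
  fix E :: "(real \<times> 'a) set" assume E: "E \<in> sets (phase T)"
  have "emeasure (cfg T ?J x) E = emeasure (count_space ?J) {j\<in>?J. x j \<in> E}"
    using assms E by (intro emeasure_cfg) auto
  also have "\<dots> = emeasure (count_space J) {j\<in>J. x j \<in> E \<inter> ({..<t} \<times> UNIV)}"
  proof -
    have "{j\<in>J. x j \<in> E \<inter> ({..<t} \<times> UNIV)} = {j\<in>?J. x j \<in> E}" by (auto simp: mem_Times_iff)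
    moreover have "{j\<in>?J. x j \<in> E} \<subseteq> J" "{j\<in>?J. x j \<in> E} \<subseteq> ?J" by auto
    ultimately show ?thesis by (simp add: emeasure_count_space)
  qed
  also have "\<dots> = emeasure (tau t (cfg T J x)) E"
    using assms E by (simp add: emeasure_tau[where T=T] cfg_in_configs emeasure_cfg early_Int_sets)
  finally show "emeasure (cfg T ?J x) E = emeasure (tau t (cfg T J x)) E" .
qed simp

lemma add_dirac_cfg:
  assumes "x \<in> insert k J \<rightarrow> space (phase T)" "k \<notin> J"
  shows "add_dirac (cfg T J x) (x k) = cfg T (insert k J) x"
proof (rule configs_eqI[symmetric])
  show "cfg T (insert k J) x \<in> configs T" using assms by (intro cfg_in_configs) auto
  fix E :: "(real \<times> 'a) set" assume E: "E \<in> sets (phase T)"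
  have "emeasure (cfg T (insert k J) x) E = emeasure (count_space (insert k J)) {j\<in>insert k J. x j \<in> E}"
    using assms E by (intro emeasure_cfg) auto
  also have "\<dots> = emeasure (count_space J) {j\<in>J. x j \<in> E} + indicator E (x k)"
  proof (cases "x k \<in> E")
    case True
    then have "{j\<in>insert k J. x j \<in> E} = insert k {j\<in>J. x j \<in> E}" by auto
    moreover have "insert k {j\<in>J. x j \<in> E} \<subseteq> insert k J" "{j\<in>J. x j \<in> E} \<subseteq> J" by auto
    ultimately show ?thesis using True assms(2)
      by (auto simp: emeasure_count_space)
  next
    case False
    then have "{j\<in>insert k J. x j \<in> E} = {j\<in>J. x j \<in> E}" by auto
    moreover have "{j\<in>J. x j \<in> E} \<subseteq> insert k J" "{j\<in>J. x j \<in> E} \<subseteq> J" by auto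
    ultimately show ?thesis using False
      by (simp add: emeasure_count_space)
  qed
  also have "\<dots> = emeasure (add_dirac (cfg T J x) (x k)) E"
    using assms E by (simp add: emeasure_add_dirac emeasure_cfg)
  finally show "emeasure (cfg T (insert k J) x) E = emeasure (add_dirac (cfg T J x) (x k)) E" .
qed simp

lemma tau_in_configs: "\<omega> \<in> configs T \<Longrightarrow> 0 \<le> t \<Longrightarrow> tau t \<omega> \<in> configs T"
  by (erule configs_cases) (auto simp: tau_cfg intro!: cfg_in_configs)

lemma add_dirac_in_configs:
  assumes "\<omega> \<in> configs T" "p \<in> space (phase T)"
  shows "add_dirac \<omega> p \<in> configs T"
proof -
  obtain J x where J: "x \<in> J \<rightarrow> space (phase T)" "\<omega> = cfg T J x"
    using assms(1) by (rule configs_cases)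
  \<comment> \<open>\<open>J\<close> may be all of the naturals, so the old indices are shifted by
    \<open>Suc\<close> to free index 0 for \<open>p\<close>.\<close>
  define y where "y = (\<lambda>j. case j of 0 \<Rightarrow> p | Suc i \<Rightarrow> x i)"
  have y: "y \<in> insert 0 (Suc ` J) \<rightarrow> space (phase T)"
    using J assms by (auto simp: y_def)
  have "\<omega> = distr (distr (count_space J) (count_space (Suc ` J)) Suc) (phase T) y"
    using y by (subst distr_distr) (auto simp: y_def J(2) cfg_def comp_def)
  also have "\<dots> = cfg T (Suc ` J) y"
    by (subst distr_bij_count_space) (auto simp: cfg_def bij_betw_def)
  finally have "add_dirac \<omega> p = cfg T (insert 0 (Suc ` J)) y"
    using add_dirac_cfg[OF y] by (simp add: y_def)
  then show ?thesis using cfg_in_configs[OF y] by simp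
qed

section \<open>Measurability of the past\<close>

text \<open>A left-continuous process is a pointwise limit of processes that are constant in time on
  the cells of a grid, and those are jointly measurable because a cell index takes countably many
  values.\<close>

lemma left_continuous_measurable:
  fixes Y :: "real \<Rightarrow> 'w \<Rightarrow> real"
  assumes meas: "\<And>s. s \<in> {0..T} \<Longrightarrow> Y s \<in> borel_measurable M"
    and lc: "\<And>w t. w \<in> space M \<Longrightarrow> t \<in> {0<..T} \<Longrightarrow> continuous (at_left t) (\<lambda>s. Y s w)"
  shows "(\<lambda>x. Y (fst x) (snd x)) \<in> borel_measurable (restrict_space borel {0..T} \<Otimes>\<^sub>M M)"
proof (cases "0 \<le> T")
  case False
  then have "space (restrict_space borel {0..T} \<Otimes>\<^sub>M M) = {}"
    by (simp add: space_pair_measure space_restrict_space)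
  then show ?thesis by (simp add: measurable_def)
next
  case T: True
  \<comment> \<open>The ceiling minus one yields the last grid point strictly before the given time,
    as a limit along \<open>at_left\<close> demands. Clamping to \<open>{0..T}\<close> keeps the
    argument among the times at which \<open>Y\<close> is known to be measurable.\<close>
  define r where "r n i = max 0 (min T ((of_int i - 1) / real (Suc n)))" for n and i :: int
  define s where "s n t = r n \<lceil>real (Suc n) * t\<rceil>" for n and t :: real
  have r: "r n i \<in> {0..T}" for n i using T by (auto simp: r_def)
  have s_lim: "filterlim (\<lambda>n. s n t) (at_left t) sequentially" if t: "t \<in> {0<..T}" for t
  proof -
    have s_eq: "s n t = (of_int \<lceil>real (Suc n) * t\<rceil> - 1) / real (Suc n)"
      and s_less: "s n t < t" and s_ge: "t - 1 / real (Suc n) \<le> s n t" for n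
    proof -
      let ?u = "(of_int \<lceil>real (Suc n) * t\<rceil> - 1) / real (Suc n)"
      have c: "of_int \<lceil>real (Suc n) * t\<rceil> - 1 < real (Suc n) * t"
        "real (Suc n) * t \<le> of_int \<lceil>real (Suc n) * t\<rceil>" by linarith+
      have "0 < \<lceil>real (Suc n) * t\<rceil>" using t by simp
      then have "0 \<le> ?u" by simp
      moreover have u: "?u < t" using c(1) by (simp add: divide_less_eq mult.commute)
      ultimately show eq: "s n t = ?u" using t by (simp add: s_def r_def)
      show "s n t < t" using u eq by simp
      have "t = (real (Suc n) * t) / real (Suc n)" by simp
      also have "\<dots> \<le> of_int \<lceil>real (Suc n) * t\<rceil> / real (Suc n)"
        using c(2) by (intro divide_right_mono) auto
      also have "\<dots> = ?u + 1 / real (Suc n)" by (simp add: field_simps)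
      finally show "t - 1 / real (Suc n) \<le> s n t" unfolding eq by simp
    qed
    have "(\<lambda>n. s n t) \<longlonglongrightarrow> t"
    proof (rule tendsto_sandwich)
      show "\<forall>\<^sub>F n in sequentially. t - 1 / real (Suc n) \<le> s n t" using s_ge by simp
      show "\<forall>\<^sub>F n in sequentially. s n t \<le> t" using s_less by (simp add: less_imp_le)
      show "(\<lambda>n. t - 1 / real (Suc n)) \<longlonglongrightarrow> t"
        using tendsto_diff[OF tendsto_const LIMSEQ_inverse_real_of_nat, of t] by (simp add: inverse_eq_divide)
    qed simp
    then show ?thesis using s_less by (auto simp: filterlim_at less_imp_neq)
  qed
  \<comment> \<open>At time 0 the hypotheses provide no left limit, so the value \<open>Y 0\<close>
    itself is used there.\<close>
  define g where "g n x = (if fst x = 0 then Y 0 (snd x) else Y (s n (fst x)) (snd x))" for n x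
  have fst_m [measurable]: "fst \<in> borel_measurable (restrict_space borel {0..T} \<Otimes>\<^sub>M M)"
    by (rule measurable_compose[OF measurable_fst]) (simp add: measurable_restrict_space1)
  show ?thesis
  proof (rule borel_measurable_LIMSEQ_real)
    fix n
    have "(\<lambda>x. Y (s n (fst x)) (snd x)) \<in> borel_measurable (restrict_space borel {0..T} \<Otimes>\<^sub>M M)"
      unfolding s_def
    proof (rule measurable_compose_countable)
      fix i
      show "(\<lambda>x. Y (r n i) (snd x)) \<in> borel_measurable (restrict_space borel {0..T} \<Otimes>\<^sub>M M)"
        using meas[OF r] by measurable
    qed measurable
    moreover have "(\<lambda>x. Y 0 (snd x)) \<in> borel_measurable (restrict_space borel {0..T} \<Otimes>\<^sub>M M)"
      using meas[of 0] T by simp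
    ultimately show "g n \<in> borel_measurable (restrict_space borel {0..T} \<Otimes>\<^sub>M M)"
      unfolding g_def by measurable
  next
    fix x assume "x \<in> space (restrict_space borel {0..T} \<Otimes>\<^sub>M M)"
    then have x: "fst x \<in> {0..T}" "snd x \<in> space M"
      by (auto simp: space_pair_measure space_restrict_space)
    show "(\<lambda>n. g n x) \<longlonglongrightarrow> Y (fst x) (snd x)"
    proof (cases "fst x = 0")
      case False
      then have t: "fst x \<in> {0<..T}" using x by auto
      have "((\<lambda>s. Y s (snd x)) \<longlongrightarrow> Y (fst x) (snd x)) (at_left (fst x))"
        using lc[OF x(2) t] by (simp add: continuous_within)
      from filterlim_compose[OF this s_lim[OF t]] False show ?thesis by (simp add: g_def)
    qed (simp add: g_def)
  qed
qed

section \<open>Sigma-fields on configurations and predictable sets\<close>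

lemma space_config_space [simp]: "space (config_space T) = configs T"
  and space_FN [simp]: "space (FN T) = configs T"
  and space_FN_upto [simp]: "space (FN_upto T t) = configs T"
  by (auto simp: config_space_def FN_def FN_upto_def intro!: space_measure_of)

lemma space_predictable_N [simp]: "space (predictable_N T) = {0..T} \<times> configs T"
  unfolding predictable_N_def by (rule space_measure_of) auto

lemma measurable_emeasure_config [measurable]:
  assumes "E \<in> sets (phase T)"
  shows "(\<lambda>\<omega>. emeasure \<omega> E) \<in> borel_measurable (config_space T)"
proof (rule measurableI)
  fix U :: "ennreal set" assume "U \<in> sets borel"
  then show "(\<lambda>\<omega>. emeasure \<omega> E) -` U \<inter> space (config_space T) \<in> sets (config_space T)"
    unfolding space_config_space unfolding config_space_def using assms
    by (intro in_measure_of) auto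
qed simp

lemma measurable_emeasure_FN_upto:
  assumes "A \<times> B \<in> sets (phase T)" "A \<subseteq> {0..t}"
  shows "(\<lambda>\<omega>. emeasure \<omega> (A \<times> B)) \<in> borel_measurable (FN_upto T t)"
proof (rule measurableI)
  fix U :: "ennreal set" assume "U \<in> sets borel"
  then show "(\<lambda>\<omega>. emeasure \<omega> (A \<times> B)) -` U \<inter> space (FN_upto T t) \<in> sets (FN_upto T t)"
    unfolding space_FN_upto unfolding FN_upto_def using assms
    by (intro in_measure_of) auto
qed simp

lemma measurable_into_config_space:
  fixes f :: "'b \<Rightarrow> (real \<times> 'a::polish_space) measure"
  assumes "f \<in> space M \<rightarrow> configs T"
    "\<And>E. E \<in> sets (phase T) \<Longrightarrow> (\<lambda>x. emeasure (f x) E) \<in> borel_measurable M"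
  shows "f \<in> measurable M (config_space T)"
  unfolding config_space_def
proof (rule measurable_measure_of)
  fix y :: "(real \<times> 'a) measure set" assume "y \<in> {{\<omega> \<in> configs T. emeasure \<omega> E \<in> U} |E U. E \<in> sets (phase T) \<and> U \<in> sets borel}"
  then obtain E U where y: "y = {\<omega> \<in> configs T. emeasure \<omega> E \<in> U}" "E \<in> sets (phase T)" "U \<in> sets borel"
    by blast
  have "f -` y \<inter> space M = (\<lambda>x. emeasure (f x) E) -` U \<inter> space M" using y assms(1) by auto
  then show "f -` y \<inter> space M \<in> sets M" using assms(2)[OF y(2)] y(3) by (simp add: measurable_sets)
qed (use assms(1) in auto)

lemma measurable_into_FN:
  fixes f :: "'b \<Rightarrow> (real \<times> 'a::polish_space) measure"
  assumes "f \<in> space M \<rightarrow> configs T"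
    "\<And>A B. A \<times> B \<in> sets (phase T) \<Longrightarrow> (\<lambda>x. emeasure (f x) (A \<times> B)) \<in> borel_measurable M"
  shows "f \<in> measurable M (FN T)"
  unfolding FN_def
proof (rule measurable_measure_of)
  fix y :: "(real \<times> 'a) measure set" assume "y \<in> {{\<omega> \<in> configs T. emeasure \<omega> (A \<times> B) \<in> U} |A B U. A \<times> B \<in> sets (phase T) \<and> U \<in> sets borel}"
  then obtain A B U where y: "y = {\<omega> \<in> configs T. emeasure \<omega> (A \<times> B) \<in> U}" "A \<times> B \<in> sets (phase T)" "U \<in> sets borel"
    by blast
  have "f -` y \<inter> space M = (\<lambda>x. emeasure (f x) (A \<times> B)) -` U \<inter> space M" using y assms(1) by auto
  then show "f -` y \<inter> space M \<in> sets M" using assms(2)[OF y(2)] y(3) by (simp add: measurable_sets)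
qed (use assms(1) in auto)

text \<open>Rectangles are among the sets whose evaluations generate \<open>config_space T\<close>.
  The lemma carries random variables, which are measurable for the sigma-field of rectangles, to the
  sigma-field on which \<open>P\<close> lives.\<close>

lemma FN_measurable_config:
  assumes "f \<in> measurable (FN T) N"
  shows "f \<in> measurable (config_space T) N"
proof -
  have "(\<lambda>\<omega>. \<omega>) \<in> measurable (config_space T) (FN T)"
    by (rule measurable_into_FN) auto
  from measurable_compose[OF this assms] show ?thesis .
qed

text \<open>A bounded, hence real-valued, encoding of the number of points in \<open>E\<close> before time \<open>t\<close>.\<close>

definition early_count :: "(real \<times> 'a) set \<Rightarrow> real \<Rightarrow> (real \<times> 'a) measure \<Rightarrow> real" where
  "early_count E t \<omega> = enn2real (inverse (1 + emeasure \<omega> (E \<inter> ({..<t} \<times> UNIV))))"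

lemma ennreal_early_count: "ennreal (early_count E t \<omega>) = inverse (1 + emeasure \<omega> (E \<inter> ({..<t} \<times> UNIV)))"
proof -
  have "inverse (1 + emeasure \<omega> (E \<inter> ({..<t} \<times> UNIV))) \<noteq> top" by (simp add: ennreal_inverse_eq_top_iff)
  then show ?thesis unfolding early_count_def by (intro ennreal_enn2real) (simp only: less_top)
qed

text \<open>The encoding loses nothing: an infinite count is encoded by 0, and
  \<open>inverse 0 - 1\<close> is infinite again. Measurability of counts can therefore be read off
  from real-valued processes.\<close>

lemma emeasure_early_count:
  "emeasure \<omega> (E \<inter> ({..<t} \<times> UNIV)) = inverse (ennreal (early_count E t \<omega>)) - 1"
  unfolding ennreal_early_count by (cases "emeasure \<omega> (E \<inter> ({..<t} \<times> UNIV))")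
    (auto simp: inverse_ennreal ennreal_minus simp flip: ennreal_1 ennreal_plus)

text \<open>Since the time bound is strict, the parts of \<open>E\<close> before \<open>s\<close>
  increase to the part before \<open>t\<close> as \<open>s\<close> increases to \<open>t\<close>.
  Continuity from below applies even to infinite counts, and inversion is continuous on the extended
  nonnegative reals.\<close>

lemma early_count_left_continuous:
  assumes "\<omega> \<in> configs T" "E \<in> sets (phase T)"
  shows "continuous (at_left t) (\<lambda>s. early_count E s \<omega>)"
proof -
  let ?e = "\<lambda>s. emeasure \<omega> (E \<inter> ({..<s} \<times> UNIV))"
  have "(?e \<longlongrightarrow> ?e t) (at_left t)"
  proof (rule tendsto_at_left_sequentially[of "t - 1"])
    fix S :: "nat \<Rightarrow> real" assume S: "\<And>n. S n < t" "incseq S" "S \<longlonglongrightarrow> t"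
    have "(\<lambda>n. ?e (S n)) \<longlonglongrightarrow> emeasure \<omega> (\<Union>n. E \<inter> ({..<S n} \<times> UNIV))"
      using assms early_Int_sets S(2)
      by (intro Lim_emeasure_incseq) (auto simp: sets_configs incseq_def intro: less_le_trans)
    moreover have "(\<Union>n. E \<inter> ({..<S n} \<times> UNIV)) = E \<inter> ({..<t} \<times> UNIV)"
    proof -
      have "\<exists>n. u < S n" if "u < t" for u
        using order_tendstoD(1)[OF S(3) that] by (auto simp: eventually_sequentially)
      moreover have "u < t" if "u < S n" for u n using that S(1)[of n] by simp
      ultimately show ?thesis by fastforce
    qed
    ultimately show "(\<lambda>n. ?e (S n)) \<longlonglongrightarrow> ?e t" by simp
  qed simp
  then have "((\<lambda>s. 1 + ?e s) \<longlongrightarrow> 1 + ?e t) (at_left t)" by (intro tendsto_add tendsto_const)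
  moreover have "continuous_on UNIV (\<lambda>x::ennreal. inverse x)" by (intro continuous_intros)
  ultimately have "((\<lambda>s. inverse (1 + ?e s)) \<longlongrightarrow> inverse (1 + ?e t)) (at_left t)"
    by (intro continuous_on_tendsto_compose[where f=inverse and s=UNIV]) auto
  then have "((\<lambda>s. inverse (1 + ?e s)) \<longlongrightarrow> ennreal (early_count E t \<omega>)) (at_left t)"
    by (simp add: ennreal_early_count)
  then have "((\<lambda>s. early_count E s \<omega>) \<longlongrightarrow> early_count E t \<omega>) (at_left t)"
    unfolding early_count_def[of E _ \<omega>] by (intro tendsto_enn2real) (auto simp: early_count_def)
  then show ?thesis by (simp add: continuous_within)
qed

lemma early_count_adapted:
  assumes E: "A \<times> B \<in> sets (phase T)"
  shows "left_cont_adapted T (early_count (A \<times> B))"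
  unfolding left_cont_adapted_def
proof (intro conjI ballI)
  fix t assume "t \<in> {0..T}"
  have "(\<lambda>\<omega>. emeasure \<omega> (A \<times> B \<inter> ({..<t} \<times> UNIV))) \<in> borel_measurable (FN_upto T t)"
  proof (cases "B = {}")
    \<comment> \<open>Only a nonempty \<open>B\<close> forces \<open>A\<close> to lie in
      \<open>{0..T}\<close>; with \<open>B\<close> empty the rectangle is measurable for every
      \<open>A\<close>.\<close>
    case False
    have eq: "A \<times> B \<inter> ({..<t} \<times> UNIV) = (A \<inter> {..<t}) \<times> B" by auto
    have "A \<inter> {..<t} \<subseteq> {0..t}"
      using False sets.sets_into_space[OF E] by (auto simp: space_phase)
    then show ?thesis
      using early_Int_sets[OF E, of t] unfolding eq by (intro measurable_emeasure_FN_upto)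
  qed simp
  then show "early_count (A \<times> B) t \<in> borel_measurable (FN_upto T t)"
    unfolding early_count_def by measurable
qed (use early_count_left_continuous[OF _ E] in auto)

lemma left_cont_adapted_predictable:
  assumes "left_cont_adapted T Y"
  shows "(\<lambda>x. Y (fst x) (snd x)) \<in> borel_measurable (predictable_N T)"
proof (rule measurableI)
  fix U :: "real set" assume U: "U \<in> sets borel"
  have "(\<lambda>x. Y (fst x) (snd x)) -` U \<inter> space (predictable_N T)
      = {(t, \<omega>). t \<in> {0..T} \<and> \<omega> \<in> configs T \<and> Y t \<omega> \<in> U}"
    by (auto simp: space_predictable_N)
  also have "\<dots> \<in> sets (predictable_N T)"
    unfolding predictable_N_def using assms U by (intro in_measure_of) auto
  finally show "(\<lambda>x. Y (fst x) (snd x)) -` U \<inter> space (predictable_N T) \<in> sets (predictable_N T)" .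
qed simp

section \<open>The two configurations compared by the operator\<close>

definition tau_insert :: "real \<times> 'a \<Rightarrow> (real \<times> 'a) measure \<Rightarrow> (real \<times> 'a) measure" where
  "tau_insert p \<omega> = add_dirac (tau (fst p) \<omega>) p"

text \<open>After \<open>tau (fst p)\<close> no point is left at time \<open>fst p\<close>, so the
  test in \<open>malliavin_D\<close> always finds \<open>p\<close> vacant and the point is always
  added. For a non-measurable singleton the test succeeds by the convention that its mass is
  0.\<close>

lemma op_H_eq:
  assumes "\<omega> \<in> configs T" "p \<in> space (phase T)"
  shows "op_H p F \<omega> = F (tau_insert p \<omega>) - F (tau (fst p) \<omega>)"
proof -
  have "emeasure (tau (fst p) \<omega>) {p} = 0"
  proof (cases "{p} \<in> sets (phase T)")
    case True
    have "{p} \<inter> ({..<fst p} \<times> UNIV) = {}" by (cases p) auto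
    then show ?thesis using assms True by (auto simp: emeasure_tau space_phase)
  qed (use assms in \<open>simp add: emeasure_notin_sets sets_configs\<close>)
  then show ?thesis by (simp add: op_H_def malliavin_D_def tau_insert_def)
qed

lemma emeasure_tau_insert:
  assumes "\<omega> \<in> configs T" "p \<in> space (phase T)" "E \<in> sets (phase T)"
  shows "emeasure (tau_insert p \<omega>) E = emeasure \<omega> (E \<inter> ({..<fst p} \<times> UNIV)) + indicator E p"
  using assms by (auto simp: tau_insert_def emeasure_add_dirac sets_configs emeasure_tau space_phase)

lemma tau_insert_in_configs: "\<omega> \<in> configs T \<Longrightarrow> p \<in> space (phase T) \<Longrightarrow> tau_insert p \<omega> \<in> configs T"
  unfolding tau_insert_def by (intro add_dirac_in_configs tau_in_configs) (auto simp: space_phase)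

lemma measurable_early_count_joint:
  assumes "E \<in> sets (phase T)"
  shows "(\<lambda>x. early_count E (fst (fst x)) (snd x)) \<in> borel_measurable (phase T \<Otimes>\<^sub>M config_space T)"
proof -
  have "early_count E s \<in> borel_measurable (config_space T)" for s
    unfolding early_count_def using early_Int_sets[OF assms, of s] by measurable
  then have "(\<lambda>x. early_count E (fst x) (snd x)) \<in> borel_measurable (restrict_space borel {0..T} \<Otimes>\<^sub>M config_space T)"
    using early_count_left_continuous[OF _ assms]
    by (intro left_continuous_measurable) auto
  moreover have "(\<lambda>x. (fst (fst x), snd x)) \<in> measurable (phase T \<Otimes>\<^sub>M config_space T) (restrict_space borel {0..T} \<Otimes>\<^sub>M config_space T)"
    unfolding phase_def by measurable
  from measurable_compose[OF this calculation] show ?thesis by simp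
qed

text \<open>Joint measurability in the point and the configuration, as Fubini's theorem requires.
  The count before a moving time is recovered from \<open>early_count\<close>, whose left-continuity
  supplies the measurability in time.\<close>

lemma measurable_tau_tau_insert:
  fixes T :: real
  defines "M \<equiv> phase T \<Otimes>\<^sub>M (config_space T :: (real \<times> 'a::polish_space) measure measure)"
  shows
  "(\<lambda>x. tau (fst (fst x)) (snd x)) \<in> measurable M (config_space T)"
  "(\<lambda>x. tau_insert (fst x) (snd x)) \<in> measurable M (config_space T)"
proof -
  note [measurable] = measurable_early_count_joint
  have 1: "(\<lambda>x. emeasure (snd x) (E \<inter> ({..<fst (fst x)} \<times> UNIV))) \<in> borel_measurable M"
    if [measurable]: "E \<in> sets (phase T)" for E :: "(real \<times> 'a) set"
    unfolding M_def emeasure_early_count by measurable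
  show "(\<lambda>x. tau (fst (fst x)) (snd x)) \<in> measurable M (config_space T)"
  proof (rule measurable_into_config_space)
    fix E :: "(real \<times> 'a) set" assume E: "E \<in> sets (phase T)"
    show "(\<lambda>x. emeasure (tau (fst (fst x)) (snd x)) E) \<in> borel_measurable M"
      using 1[OF E] by (rule measurable_cong[THEN iffD1, rotated])
        (use E in \<open>auto simp: M_def space_pair_measure space_phase emeasure_tau\<close>)
  qed (auto simp: M_def space_pair_measure space_phase intro!: tau_in_configs)
  show "(\<lambda>x. tau_insert (fst x) (snd x)) \<in> measurable M (config_space T)"
  proof (rule measurable_into_config_space)
    fix E :: "(real \<times> 'a) set" assume E [measurable]: "E \<in> sets (phase T)"
    note [measurable] = 1[OF E, unfolded M_def]
    have "(\<lambda>x. emeasure (snd x) (E \<inter> ({..<fst (fst x)} \<times> UNIV)) + indicator E (fst x)) \<in> borel_measurable M"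
      unfolding M_def by measurable
    then show "(\<lambda>x. emeasure (tau_insert (fst x) (snd x)) E) \<in> borel_measurable M"
      by (rule measurable_cong[THEN iffD1, rotated]) (use E in \<open>auto simp: M_def space_pair_measure emeasure_tau_insert\<close>)
  qed (auto simp: M_def space_pair_measure intro!: tau_insert_in_configs)
qed

text \<open>Both configurations use only points strictly before the current time, apart from the
  current point itself, whose time is a deterministic left-continuous process. The target is
  \<open>FN T\<close> because its generators are rectangles, the sets whose early counts are known
  to be adapted.\<close>

lemma measurable_tau_tau_insert_predictable:
  fixes T :: real
  defines "M \<equiv> predictable T :: ((real \<times> (real \<times> 'a::polish_space) measure) \<times> 'a) measure"
  shows
  "(\<lambda>z. tau (fst (fst z)) (snd (fst z))) \<in> measurable M (FN T)"
  "(\<lambda>z. tau_insert (fst (fst z), snd z) (snd (fst z))) \<in> measurable M (FN T)"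
proof -
  have sp: "space M = ({0..T} \<times> configs T) \<times> UNIV"
    by (simp add: M_def predictable_def space_pair_measure)
  have 1: "(\<lambda>z. emeasure (snd (fst z)) (A \<times> B \<inter> ({..<fst (fst z)} \<times> UNIV))) \<in> borel_measurable M"
    if "A \<times> B \<in> sets (phase T)" for A and B :: "'a set"
  proof -
    have "(\<lambda>z. early_count (A \<times> B) (fst (fst z)) (snd (fst z))) \<in> borel_measurable M"
      unfolding M_def predictable_def
      using measurable_compose[OF measurable_fst left_cont_adapted_predictable[OF early_count_adapted[OF that]]] .
    then show ?thesis unfolding emeasure_early_count by measurable
  qed
  show "(\<lambda>z. tau (fst (fst z)) (snd (fst z))) \<in> measurable M (FN T)"
  proof (rule measurable_into_FN)
    fix A :: "real set" and B :: "'a set" assume E: "A \<times> B \<in> sets (phase T)"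
    show "(\<lambda>z. emeasure (tau (fst (fst z)) (snd (fst z))) (A \<times> B)) \<in> borel_measurable M"
      using 1[OF E] by (rule measurable_cong[THEN iffD1, rotated]) (use E in \<open>auto simp: sp emeasure_tau\<close>)
  qed (auto simp: sp intro!: tau_in_configs)
  have m: "(\<lambda>z. (fst (fst z), snd z)) \<in> measurable M (phase T)"
  proof -
    have "fst \<in> measurable (predictable_N T) (restrict_space borel {0..T})"
    proof (rule measurable_restrict_space2)
      have "left_cont_adapted T (\<lambda>t \<omega>. t)"
        by (auto simp: left_cont_adapted_def)
      from left_cont_adapted_predictable[OF this] show "fst \<in> borel_measurable (predictable_N T)" by simp
    qed auto
    then show ?thesis unfolding M_def predictable_def phase_def by measurable
  qed
  show "(\<lambda>z. tau_insert (fst (fst z), snd z) (snd (fst z))) \<in> measurable M (FN T)"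
  proof (rule measurable_into_FN)
    fix A :: "real set" and B :: "'a set" assume E: "A \<times> B \<in> sets (phase T)"
    note [measurable] = 1[OF E] measurable_compose[OF m borel_measurable_indicator[OF E]]
    have "(\<lambda>z. emeasure (snd (fst z)) (A \<times> B \<inter> ({..<fst (fst z)} \<times> UNIV)) + indicator (A \<times> B) (fst (fst z), snd z)) \<in> borel_measurable M"
      by measurable
    then show "(\<lambda>z. emeasure (tau_insert (fst (fst z), snd z) (snd (fst z))) (A \<times> B)) \<in> borel_measurable M"
      by (rule measurable_cong[THEN iffD1, rotated]) (use E in \<open>auto simp: sp emeasure_tau_insert space_phase\<close>)
  qed (auto simp: sp space_phase intro!: tau_insert_in_configs)
qed

lemma predictable_section:
  fixes \<omega> :: "(real \<times> 'a::polish_space) measure"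
  assumes "\<omega> \<in> configs T"
  shows "(\<lambda>p. ((fst p, \<omega>), snd p)) \<in> measurable (phase T) (predictable T)"
proof -
  have "(\<lambda>t. (t, \<omega>)) \<in> measurable (restrict_space borel {0..T}) (predictable_N T)"
    unfolding predictable_N_def
  proof (rule measurable_measure_of)
    fix y :: "(real \<times> (real \<times> 'a) measure) set" assume "y \<in> {{(t, \<omega>). t \<in> {0..T} \<and> \<omega> \<in> configs T \<and> Y t \<omega> \<in> U} |Y U. left_cont_adapted T Y \<and> U \<in> sets borel}"
    then obtain Y U where y: "y = {(t, \<omega>). t \<in> {0..T} \<and> \<omega> \<in> configs T \<and> Y t \<omega> \<in> U}"
      "left_cont_adapted T Y" "U \<in> sets borel" by blast
    \<comment> \<open>With the configuration fixed, only the time path matters. The counting space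
      makes every function of the configuration measurable, so left-continuity alone gives a Borel
      path.\<close>
    have "(\<lambda>x. Y (fst x) (snd x)) \<in> borel_measurable (restrict_space borel {0..T} \<Otimes>\<^sub>M count_space (configs T))"
      using y(2) by (intro left_continuous_measurable) (auto simp: left_cont_adapted_def)
    from measurable_compose[OF measurable_Pair2'[of \<omega> "count_space (configs T)"] this] assms
    have "(\<lambda>t. Y t \<omega>) \<in> borel_measurable (restrict_space borel {0..T})"
      by simp
    then have "(\<lambda>t. Y t \<omega>) -` U \<inter> space (restrict_space borel {0..T}) \<in> sets (restrict_space borel {0..T})"
      using y(3) by (rule measurable_sets)
    moreover have "(\<lambda>t. (t, \<omega>)) -` y \<inter> space (restrict_space borel {0..T})
        = (\<lambda>t. Y t \<omega>) -` U \<inter> space (restrict_space borel {0..T})"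
      using y(1) assms by (auto simp: space_restrict_space)
    ultimately show "(\<lambda>t. (t, \<omega>)) -` y \<inter> space (restrict_space borel {0..T}) \<in> sets (restrict_space borel {0..T})"
      by simp
  qed (use assms in \<open>auto simp: space_restrict_space\<close>)
  then show ?thesis unfolding predictable_def phase_def by measurable
qed

lemma measurable_section_tau:
  fixes p :: "real \<times> 'a::polish_space"
  assumes "p \<in> space (phase T)"
  shows "tau (fst p) \<in> measurable (config_space T) (config_space T :: (real \<times> 'a::polish_space) measure measure)"
    and "tau_insert p \<in> measurable (config_space T) (config_space T)"
  using measurable_compose[OF measurable_Pair1'[OF assms] measurable_tau_tau_insert(1)]
    measurable_compose[OF measurable_Pair1'[OF assms] measurable_tau_tau_insert(2)] by simp_all

section \<open>Void probabilities\<close>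

definition slice :: "real \<Rightarrow> nat \<Rightarrow> nat \<Rightarrow> (real \<times> 'a::polish_space) set" where
  "slice T n j = {p \<in> space (phase T). nat \<lfloor>real n * fst p / T\<rfloor> = j}"

lemma slice_sets [measurable]: "slice T n j \<in> sets (phase T)"
  unfolding slice_def by measurable

lemma in_slice: "p \<in> space (phase T) \<Longrightarrow> p \<in> slice T n (nat \<lfloor>real n * fst p / T\<rfloor>)"
  by (simp add: slice_def)

text \<open>For positive \<open>n\<close> the index \<open>n\<close> itself is attained only at the
  final time \<open>T\<close>; this is why sums over slices have \<open>n + 1\<close> terms.\<close>

lemma slice_index_le:
  assumes "0 < T" "p \<in> space (phase T)"
  shows "nat \<lfloor>real n * fst p / T\<rfloor> \<le> n"
proof -
  have "real n * fst p / T \<le> real n"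
    using assms mult_left_mono[of "fst p" T "real n"] by (simp add: space_phase mem_Times_iff divide_le_eq)
  then have "\<lfloor>real n * fst p / T\<rfloor> \<le> int n" by linarith
  then show ?thesis by simp
qed

lemma emeasure_slices:
  assumes "0 < T" "sets \<mu> = sets (phase T)" "E \<in> sets (phase T)"
  shows "emeasure \<mu> E = (\<Sum>j\<le>n. emeasure \<mu> (E \<inter> slice T n j))"
proof -
  have "(\<Union>j\<le>n. E \<inter> slice T n j) = E"
  proof (intro equalityI subsetI)
    fix p assume p: "p \<in> E"
    then have "p \<in> space (phase T)" using sets.sets_into_space[OF assms(3)] by auto
    with p show "p \<in> (\<Union>j\<le>n. E \<inter> slice T n j)"
      using slice_index_le[OF assms(1), of p n] in_slice[of p T n]
      by (intro UN_I[of "nat \<lfloor>real n * fst p / T\<rfloor>"]) simp_all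
  qed auto
  moreover have "(\<Sum>j\<le>n. emeasure \<mu> (E \<inter> slice T n j)) = emeasure \<mu> (\<Union>j\<le>n. E \<inter> slice T n j)"
  proof (rule sum_emeasure)
    show "(\<lambda>j. E \<inter> slice T n j) ` {..n} \<subseteq> sets \<mu>"
      unfolding assms(2) by (intro image_subsetI sets.Int assms(3) slice_sets)
    show "disjoint_family_on (\<lambda>j. E \<inter> slice T n j) {..n}"
      unfolding disjoint_family_on_def slice_def by blast
  qed simp
  ultimately show ?thesis by simp
qed

text \<open>Slices are time intervals of length \<open>T / n\<close>, so a separated configuration is finite and the
  times of its points are pairwise distinct.\<close>

definition separated :: "real \<Rightarrow> (real \<times> 'a::polish_space) measure \<Rightarrow> bool" where
  "separated T \<omega> \<longleftrightarrow> \<omega> \<in> configs T \<and> (\<exists>n. \<forall>j\<le>n. emeasure \<omega> (slice T n j) \<le> 1)"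

definition hits :: "real \<Rightarrow> nat \<Rightarrow> (real \<times> 'a::polish_space) set \<Rightarrow> (real \<times> 'a) measure \<Rightarrow> ennreal" where
  "hits T n E \<omega> = (\<Sum>j\<le>n. if emeasure \<omega> (E \<inter> slice T n j) = 0 then 0 else 1)"

text \<open>A slice that is hit holds at least one point, so hits never exceed the count. At the
  \<open>n\<close> that witnesses separation a slice holds at most one point, so the supremum is
  attained there. Taking the supremum gives one formula for all configurations although the witness
  depends on the configuration.\<close>

lemma SUP_hits:
  assumes T: "0 < T" and g: "separated T \<omega>" and E: "E \<in> sets (phase T)"
  shows "(SUP n. hits T n E \<omega>) = emeasure \<omega> E"
proof -
  have \<omega>: "\<omega> \<in> configs T" using g by (simp add: separated_def)
  have eq: "emeasure \<omega> E = (\<Sum>j\<le>n. emeasure \<omega> (E \<inter> slice T n j))" for n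
    by (rule emeasure_slices[OF T sets_configs[OF \<omega>] E])
  have ge: "1 \<le> emeasure \<omega> (E \<inter> slice T n j)" if "emeasure \<omega> (E \<inter> slice T n j) \<noteq> 0" for n j
    using configs_ge_1[OF \<omega> _ that] E by simp
  have le: "hits T n E \<omega> \<le> emeasure \<omega> E" for n
    unfolding eq[of n] hits_def using ge by (intro sum_mono) simp
  obtain n where n: "\<And>j. j \<le> n \<Longrightarrow> emeasure \<omega> (slice T n j) \<le> 1"
    using g by (auto simp: separated_def)
  have "emeasure \<omega> (E \<inter> slice T n j) \<le> 1" if "j \<le> n" for j
  proof -
    have "emeasure \<omega> (E \<inter> slice T n j) \<le> emeasure \<omega> (slice T n j)"
      by (intro emeasure_mono) (simp_all add: sets_configs[OF \<omega>] slice_sets)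
    with n[OF that] show ?thesis by (rule order_trans[rotated])
  qed
  then have "emeasure \<omega> E \<le> hits T n E \<omega>"
    unfolding eq[of n] hits_def by (intro sum_mono) simp
  then show ?thesis
    using le by (intro antisym SUP_least SUP_upper2[of n]) simp_all
qed

section \<open>Void events as a generator\<close>

definition void :: "real \<Rightarrow> (real \<times> 'a::polish_space) set \<Rightarrow> (real \<times> 'a) measure set" where
  "void T E = {\<omega>\<in>configs T. emeasure \<omega> E = 0}"

definition void_space :: "real \<Rightarrow> (real \<times> 'a::polish_space) measure measure" where
  "void_space T = sigma (configs T) (void T ` sets (phase T))"

lemma void_subset: "void T ` sets (phase T) \<subseteq> Pow (configs T)"
  by (auto simp: void_def)

lemma sets_void_space: "sets (void_space T) = sigma_sets (configs T) (void T ` sets (phase T))"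
  and space_void_space [simp]: "space (void_space T) = configs T"
  unfolding void_space_def by (simp_all add: sets_measure_of space_measure_of void_subset)

lemma void_in_config_space: "E \<in> sets (phase T) \<Longrightarrow> void T E \<in> sets (config_space T)"
proof -
  assume "E \<in> sets (phase T)"
  then have "{\<omega>\<in>space (config_space T). emeasure \<omega> E = 0} \<in> sets (config_space T)" by measurable
  then show ?thesis by (simp add: void_def)
qed

text \<open>For a generator, \<open>SUP_hits\<close> replaces the count by a function of void
  events. Agreement on separated configurations with some set from \<open>void_space T\<close> then
  survives complements and countable unions.\<close>

lemma void_space_approx:
  fixes B :: "(real \<times> 'a::polish_space) measure set"
  assumes T: "0 < T" and B: "B \<in> sets (config_space T)"
  shows "\<exists>B'\<in>sets (void_space T). \<forall>\<omega>. separated T \<omega> \<longrightarrow> (\<omega> \<in> B \<longleftrightarrow> \<omega> \<in> B')"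
proof -
  let ?G = "{{\<omega>\<in>configs T. emeasure \<omega> E \<in> U} | (E :: (real \<times> 'a) set) U. E \<in> sets (phase T) \<and> U \<in> sets borel}"
  have "B \<in> sigma_sets (configs T) ?G"
    using B unfolding config_space_def by (subst (asm) sets_measure_of) auto
  then show ?thesis
  proof induction
    case (Basic a)
    then obtain E U where a: "a = {\<omega>\<in>configs T. emeasure \<omega> E \<in> U}" "E \<in> sets (phase T)" "U \<in> sets borel"
      by blast
    have "{\<omega>\<in>space (void_space T). emeasure \<omega> D = 0} \<in> sets (void_space T)" if "D \<in> sets (phase T)" for D :: "(real \<times> 'a) set"
      using that by (auto simp: sets_void_space void_def[symmetric])
    then have [measurable]: "(\<lambda>\<omega>. hits T n E \<omega>) \<in> borel_measurable (void_space T)" for n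
      unfolding hits_def using a(2) by (intro borel_measurable_sum measurable_If) auto
    have "(\<lambda>\<omega>. SUP n. hits T n E \<omega>) -` U \<inter> space (void_space T) \<in> sets (void_space T)"
      using a(3) by (intro measurable_sets[OF _ a(3)]) measurable
    then show ?case
      using a by (rule_tac bexI) (auto simp: SUP_hits[OF T _ a(2)] separated_def)
  next
    case Empty
    then show ?case by (intro bexI[of _ "{}"]) auto
  next
    case (Compl a)
    then obtain B' where "B' \<in> sets (void_space T)" "\<forall>\<omega>. separated T \<omega> \<longrightarrow> (\<omega> \<in> a \<longleftrightarrow> \<omega> \<in> B')" by blast
    moreover from this have "configs T - B' \<in> sets (void_space T)"
      using sets.compl_sets by fastforce
    ultimately show ?case by (intro bexI[of _ "configs T - B'"]) (auto simp: separated_def)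
  next
    case (Union a)
    then obtain B' where "\<And>i. B' i \<in> sets (void_space T)" "\<And>i \<omega>. separated T \<omega> \<Longrightarrow> (\<omega> \<in> a i \<longleftrightarrow> \<omega> \<in> B' i)" by metis
    then show ?case by (intro bexI[of _ "\<Union>i. B' i"]) auto
  qed
qed

lemma emeasure_Un_eq_0:
  assumes "A \<in> sets M" "B \<in> sets M"
  shows "emeasure M (A \<union> B) = 0 \<longleftrightarrow> emeasure M A = 0 \<and> emeasure M B = 0"
proof
  assume "emeasure M (A \<union> B) = 0"
  then show "emeasure M A = 0 \<and> emeasure M B = 0"
    using emeasure_mono[of A "A \<union> B" M] emeasure_mono[of B "A \<union> B" M] assms by auto
next
  assume "emeasure M A = 0 \<and> emeasure M B = 0"
  then show "emeasure M (A \<union> B) = 0"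
    using emeasure_subadditive[OF assms] by simp
qed

text \<open>Renyi's theorem: void events are closed under intersection, and on configurations with
  distinct times they generate the whole sigma-field, since the number of points in \<open>E\<close> is the
  supremum over \<open>n\<close> of the number of slices of \<open>E\<close> that are hit.\<close>

lemma void_probabilities_unique:
  fixes \<mu> \<nu> :: "(real \<times> 'a::polish_space) measure measure"
  assumes T: "0 < T"
    and sets: "sets \<mu> = sets (config_space T)" "sets \<nu> = sets (config_space T)"
    and fin: "emeasure \<mu> (configs T) \<noteq> \<infinity>"
    and separated: "AE \<omega> in \<mu>. separated T \<omega>" "AE \<omega> in \<nu>. separated T \<omega>"
    and void: "\<And>E. E \<in> sets (phase T) \<Longrightarrow> emeasure \<mu> (void T E) = emeasure \<nu> (void T E)"
  shows "\<mu> = \<nu>"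
proof (rule measure_eqI)
  have space: "space \<mu> = configs T" "space \<nu> = configs T"
    using sets[THEN sets_eq_imp_space_eq] by simp_all
  have sub: "sets (void_space T) \<subseteq> sets (config_space T :: (real \<times> 'a) measure measure)"
  proof -
    have "void T ` sets (phase T) \<subseteq> sets (config_space T :: (real \<times> 'a) measure measure)"
      by (intro image_subsetI void_in_config_space)
    from sets.sigma_sets_subset[OF this] show ?thesis by (simp add: sets_void_space)
  qed
  have id: "(\<lambda>\<omega>. \<omega>) \<in> measurable \<mu> (void_space T)" "(\<lambda>\<omega>. \<omega>) \<in> measurable \<nu> (void_space T)"
  proof -
    have "B \<inter> configs T \<in> sets (config_space T)" if "B \<in> sets (void_space T)" for B :: "(real \<times> 'a) measure set"
      using subsetD[OF sub that] sets.Int_space_eq2[OF subsetD[OF sub that]] by simp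
    then show "(\<lambda>\<omega>. \<omega>) \<in> measurable \<mu> (void_space T)" "(\<lambda>\<omega>. \<omega>) \<in> measurable \<nu> (void_space T)"
      by (auto intro!: measurableI simp: sets space)
  qed
  have em: "emeasure (distr \<mu> (void_space T) (\<lambda>\<omega>. \<omega>)) B = emeasure \<mu> B"
    "emeasure (distr \<nu> (void_space T) (\<lambda>\<omega>. \<omega>)) B = emeasure \<nu> B" if "B \<in> sets (void_space T)" for B
    using that id sets.sets_into_space[OF that] space by (simp_all add: emeasure_distr Int_absorb2)
  have v: "void T E \<in> sets (void_space T)" if "E \<in> sets (phase T)" for E :: "(real \<times> 'a) set"
    using that by (auto simp: sets_void_space)
  have eqV: "distr \<mu> (void_space T) (\<lambda>\<omega>. \<omega>) = distr \<nu> (void_space T) (\<lambda>\<omega>. \<omega>)"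
  proof (rule measure_eqI_generator_eq[where E="void T ` sets (phase T)" and \<Omega>="configs T" and A="\<lambda>_. configs T"])
    show "Int_stable (void T ` sets (phase T :: (real \<times> 'a) measure))"
    proof (rule Int_stableI, safe)
      fix D E :: "(real \<times> 'a) set" assume DE: "D \<in> sets (phase T)" "E \<in> sets (phase T)"
      have "void T D \<inter> void T E = void T (D \<union> E)"
      proof -
        have "emeasure \<omega> (D \<union> E) = 0 \<longleftrightarrow> emeasure \<omega> D = 0 \<and> emeasure \<omega> E = 0" if "\<omega> \<in> configs T" for \<omega>
          using DE by (simp add: emeasure_Un_eq_0 sets_configs[OF that])
        then show ?thesis unfolding void_def by blast
      qed
      then show "void T D \<inter> void T E \<in> void T ` sets (phase T)" using DE by (simp add: imageI)
    qed
    \<comment> \<open>The empty set makes the whole space a void event, so equality of total masses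
      is one of the void probabilities.\<close>
    have c: "configs T = void T {}" by (auto simp: void_def)
    show "range (\<lambda>_. configs T) \<subseteq> void T ` sets (phase T :: (real \<times> 'a) measure)"
      unfolding c by blast
    show "emeasure (distr \<mu> (void_space T) (\<lambda>\<omega>. \<omega>)) (configs T) \<noteq> \<infinity>"
      using fin em(1)[OF sets.top] by simp
    fix X assume "X \<in> void T ` sets (phase T :: (real \<times> 'a) measure)"
    then obtain E where "X = void T E" "E \<in> sets (phase T :: (real \<times> 'a) measure)" by blast
    then show "emeasure (distr \<mu> (void_space T) (\<lambda>\<omega>. \<omega>)) X = emeasure (distr \<nu> (void_space T) (\<lambda>\<omega>. \<omega>)) X"
      using em[OF v] void by simp
  next
    show "(\<Union>i::nat. configs T) = configs T" by simp
    show "void T ` sets (phase T :: (real \<times> 'a) measure) \<subseteq> Pow (configs T)" by (rule void_subset)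
    show "sets (distr \<mu> (void_space T) (\<lambda>\<omega>. \<omega>)) = sigma_sets (configs T) (void T ` sets (phase T))"
      "sets (distr \<nu> (void_space T) (\<lambda>\<omega>. \<omega>)) = sigma_sets (configs T) (void T ` sets (phase T))"
      by (simp_all only: sets_distr sets_void_space)
  qed
  show "sets \<mu> = sets \<nu>" using sets by simp
  fix B assume "B \<in> sets \<mu>"
  then have B: "B \<in> sets (config_space T)" using sets by simp
  obtain B' where B': "B' \<in> sets (void_space T)" "\<And>\<omega>. separated T \<omega> \<Longrightarrow> (\<omega> \<in> B \<longleftrightarrow> \<omega> \<in> B')"
    using void_space_approx[OF T B] by blast
  \<comment> \<open>\<open>B\<close> and \<open>B'\<close> differ only on configurations that are
    not separated, which are negligible for both measures.\<close>
  have "emeasure \<mu> B = emeasure \<mu> B'"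
    using B'(2) B sets subsetD[OF sub B'(1)] by (intro emeasure_eq_AE eventually_mono[OF separated(1)]) simp_all
  also have "\<dots> = emeasure \<nu> B'" using em[OF B'(1)] eqV by simp
  also have "\<dots> = emeasure \<nu> B"
    using B'(2) B sets subsetD[OF sub B'(1)] by (intro emeasure_eq_AE eventually_mono[OF separated(2)]) simp_all
  finally show "emeasure \<mu> B = emeasure \<nu> B" .
qed

lemma separated_in_config_space: "{\<omega>\<in>configs T. separated T \<omega>} \<in> sets (config_space T :: (real \<times> 'a::polish_space) measure measure)"
proof -
  let ?C = "config_space T :: (real \<times> 'a) measure measure"
  have [measurable]: "Measurable.pred ?C (\<lambda>\<omega>. emeasure \<omega> (slice T n j) \<le> 1)" for n j
    using measurable_emeasure_config[OF slice_sets] by measurable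
  have "{\<omega>\<in>space ?C. \<exists>n. \<forall>j\<in>{..n}. emeasure \<omega> (slice T n j) \<le> 1} \<in> sets ?C"
    by measurable
  moreover have "{\<omega>\<in>space ?C. \<exists>n. \<forall>j\<in>{..n}. emeasure \<omega> (slice T n j) \<le> 1} = {\<omega>\<in>configs T. separated T \<omega>}"
    by (auto simp: separated_def)
  ultimately show ?thesis by simp
qed

lemma separated_tau:
  assumes "separated T \<omega>" "0 \<le> t"
  shows "separated T (tau t \<omega>)"
proof -
  obtain n where \<omega>: "\<omega> \<in> configs T" and n: "\<And>j. j \<le> n \<Longrightarrow> emeasure \<omega> (slice T n j) \<le> 1"
    using assms(1) by (auto simp: separated_def)
  have "emeasure (tau t \<omega>) (slice T n j) \<le> 1" if "j \<le> n" for j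
  proof -
    have "emeasure (tau t \<omega>) (slice T n j) = emeasure \<omega> (slice T n j \<inter> ({..<t} \<times> UNIV))"
      by (rule emeasure_tau[OF \<omega> assms(2) slice_sets])
    also have "\<dots> \<le> emeasure \<omega> (slice T n j)"
      by (intro emeasure_mono) (simp_all add: sets_configs[OF \<omega>] slice_sets)
    also have "\<dots> \<le> 1" by (rule n[OF that])
    finally show ?thesis .
  qed
  then show ?thesis using tau_in_configs[OF \<omega> assms(2)] by (auto simp: separated_def)
qed

lemma nn_integral_distr_density:
  assumes [measurable]: "h \<in> measurable M N" "w \<in> borel_measurable M" "g \<in> borel_measurable N"
  shows "(\<integral>\<^sup>+x. g x \<partial>distr (density M w) N h) = (\<integral>\<^sup>+x. w x * g (h x) \<partial>M)"
proof -
  have "(\<integral>\<^sup>+x. g x \<partial>distr (density M w) N h) = (\<integral>\<^sup>+x. g (h x) \<partial>density M w)"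
    by (rule nn_integral_distr) simp_all
  also have "\<dots> = (\<integral>\<^sup>+x. w x * g (h x) \<partial>M)"
    by (rule nn_integral_density) measurable
  finally show ?thesis .
qed

lemma emeasure_distr_density:
  assumes "h \<in> measurable M N" "w \<in> borel_measurable M" "A \<in> sets N"
  shows "emeasure (distr (density M w) N h) A = (\<integral>\<^sup>+x. w x * indicator A (h x) \<partial>M)"
  using nn_integral_distr_density[OF assms(1,2) borel_measurable_indicator[OF assms(3)]] assms(3) by simp

section \<open>Poisson configurations with finite intensity\<close>

text \<open>The first expression is the union bound, over the \<open>n + 2\<close> slices at level
  \<open>n + 1\<close>, for two points in one slice. The extra term bounds the probability that the
  slice of an inserted point is already occupied.\<close>

lemma crowding_bound_tendsto_0:
  "(\<lambda>n. real (Suc (Suc n)) * (r / real (Suc n))\<^sup>2) \<longlonglongrightarrow> 0"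
  "(\<lambda>n. real (Suc (Suc n)) * (r / real (Suc n))\<^sup>2 + r / real (Suc n)) \<longlonglongrightarrow> 0"
proof -
  have a: "(\<lambda>n. real (Suc (Suc n)) / (real (Suc n))\<^sup>2) \<longlonglongrightarrow> 0" "(\<lambda>n. 1 / real (Suc n)) \<longlonglongrightarrow> 0"
    by real_asymp+
  show 1: "(\<lambda>n. real (Suc (Suc n)) * (r / real (Suc n))\<^sup>2) \<longlonglongrightarrow> 0"
    using tendsto_mult_right_zero[OF a(1), of "r\<^sup>2"] by (simp add: power_divide mult.commute)
  show "(\<lambda>n. real (Suc (Suc n)) * (r / real (Suc n))\<^sup>2 + r / real (Suc n)) \<longlonglongrightarrow> 0"
    using tendsto_add[OF 1 tendsto_mult_right_zero[OF a(2), of r]] by simp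
qed

locale finite_poisson =
  fixes T :: real and \<pi> :: "'a::polish_space measure" and P :: "(real \<times> 'a) measure measure"
  assumes T_pos: "0 < T"
    and sets_\<pi>: "sets \<pi> = sets borel"
    and sigma_finite_\<pi>: "sigma_finite_measure \<pi>"
    and law: "poisson_law T \<pi> P"
    and rho_finite: "emeasure (rho T \<pi>) (space (rho T \<pi>)) < \<infinity>"
begin

abbreviation "\<rho> \<equiv> rho T \<pi>"

definition "R = measure \<rho> (space (phase T))"

lemma sets_rho [measurable_cong, simp]: "sets \<rho> = sets (phase T)"
  unfolding rho_def phase_def
  by (intro sets_pair_measure_cong) (simp_all add: sets_\<pi> sets_restrict_space)

lemma space_rho [simp]: "space \<rho> = space (phase T)"
  using sets_rho by (rule sets_eq_imp_space_eq)

lemma sets_P [measurable_cong, simp]: "sets P = sets (config_space T)"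
  and space_P [simp]: "space P = configs T"
  using law by (simp_all add: poisson_law_def)

sublocale P: prob_space P
  using law by (simp add: poisson_law_def poisson_random_measure_def)

sublocale rho: finite_measure \<rho>
  using rho_finite by (intro finite_measureI) auto

sublocale pair: pair_sigma_finite \<rho> P
  by unfold_locales

lemma rho_le_R: "measure \<rho> E \<le> R"
  unfolding R_def using rho.bounded_measure[of E] by simp

lemma poisson:
  assumes "E \<in> sets (phase T)"
  shows "measure P {\<omega>\<in>configs T. emeasure \<omega> E = of_nat k} = exp (- measure \<rho> E) * measure \<rho> E ^ k / fact k"
proof -
  have "emeasure \<rho> E < \<infinity>" using rho.emeasure_finite[of E]
    unfolding infinity_ennreal_def less_top[symmetric] by simp
  then show ?thesis
    using law assms by (simp add: poisson_law_def poisson_random_measure_def)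
qed

lemma measure_void: "E \<in> sets (phase T) \<Longrightarrow> measure P (void T E) = exp (- measure \<rho> E)"
  using poisson[of E 0] by (simp add: void_def)

lemma emeasure_void: "E \<in> sets (phase T) \<Longrightarrow> emeasure P (void T E) = ennreal (exp (- measure \<rho> E))"
  by (simp add: P.emeasure_eq_measure measure_void)

section \<open>Almost sure separation of points\<close>

lemma multiple_in_sets: "E \<in> sets (phase T) \<Longrightarrow> {\<omega>\<in>configs T. \<not> emeasure \<omega> E \<le> 1} \<in> sets (config_space T)"
proof -
  assume [measurable]: "E \<in> sets (phase T)"
  have "{\<omega>\<in>space (config_space T). \<not> emeasure \<omega> E \<le> 1} \<in> sets (config_space T)" by measurable
  then show ?thesis by simp
qed

text \<open>With r the intensity of \<open>E\<close>, at most one point occurs with probability exp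
  (- r) * (1 + r), which is at least (1 - r) * (1 + r). Passing to the complement avoids summing the
  tail and covers the infinite count as well.\<close>

lemma measure_multiple:
  assumes E: "E \<in> sets (phase T)"
  shows "measure P {\<omega>\<in>configs T. \<not> emeasure \<omega> E \<le> 1} \<le> (measure \<rho> E)\<^sup>2"
proof -
  let ?r = "measure \<rho> E"
  let ?A = "\<lambda>k::nat. {\<omega>\<in>configs T. emeasure \<omega> E = of_nat k}"
  have A [measurable]: "?A k \<in> sets (config_space T)" for k
  proof -
    note E [measurable]
    have "{\<omega>\<in>space (config_space T). emeasure \<omega> E = of_nat k} \<in> sets (config_space T)" by measurable
    then show ?thesis by simp
  qed
  have "measure P (?A 0 \<union> ?A 1) = measure P (?A 0) + measure P (?A 1)"
    using A[of 0] A[of 1] by (intro P.finite_measure_Union) auto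
  also have "\<dots> = exp (- ?r) * (1 + ?r)"
    using poisson[OF E, of 0] poisson[OF E, of 1] by (simp add: algebra_simps)
  also have "\<dots> \<ge> (1 - ?r) * (1 + ?r)"
    using exp_ge_add_one_self[of "- ?r"] by (intro mult_right_mono) auto
  finally have ge: "1 - ?r\<^sup>2 \<le> measure P (?A 0 \<union> ?A 1)"
    by (simp add: power2_eq_square algebra_simps)
  have "{\<omega>\<in>configs T. \<not> emeasure \<omega> E \<le> 1} \<subseteq> space P - (?A 0 \<union> ?A 1)" by auto
  then have "measure P {\<omega>\<in>configs T. \<not> emeasure \<omega> E \<le> 1} \<le> measure P (space P - (?A 0 \<union> ?A 1))"
    using A[folded sets_P] by (intro P.finite_measure_mono sets.compl_sets sets.Un)
  also have "\<dots> = 1 - measure P (?A 0 \<union> ?A 1)"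
    using A[of 0] A[of 1] by (intro P.prob_compl) (simp add: sets.Un)
  finally show ?thesis using ge by simp
qed

lemma emeasure_strip:
  assumes "A \<in> sets borel" "A \<subseteq> {0..T}"
  shows "emeasure \<rho> (A \<times> UNIV) = emeasure lborel A * emeasure \<pi> UNIV"
proof -
  interpret \<pi>: sigma_finite_measure \<pi> by (rule sigma_finite_\<pi>)
  have "UNIV \<in> sets \<pi>" by (simp add: sets_\<pi>)
  moreover have "A \<in> sets (restrict_space lborel {0..T})"
    using assms by (simp add: sets_restrict_space_iff)
  ultimately have "emeasure \<rho> (A \<times> UNIV) = emeasure (restrict_space lborel {0..T}) A * emeasure \<pi> UNIV"
    unfolding rho_def by (rule \<pi>.emeasure_pair_measure_Times[rotated])
  then show ?thesis using assms by (simp add: emeasure_restrict_space)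
qed

text \<open>The intensity is uniform in time, so a strip of duration \<open>T / n\<close> carries at
  most the fraction \<open>1 / n\<close> of \<open>R\<close>. The computation stays in the extended
  reals, where \<open>R\<close> is \<open>T\<close> times the mass of \<open>\<pi>\<close>.\<close>

lemma measure_slice:
  assumes "0 < n"
  shows "measure \<rho> (slice T n j) \<le> R / real n"
proof -
  let ?A = "{0..T} \<inter> {T * real j / real n ..< T * (real j + 1) / real n}"
  have "emeasure \<rho> (space (phase T)) = ennreal T * emeasure \<pi> UNIV"
    using emeasure_strip[of "{0..T}"] T_pos by (simp add: space_phase)
  then have R: "ennreal R = ennreal T * emeasure \<pi> UNIV"
    by (simp add: R_def rho.emeasure_eq_measure)
  have sub: "slice T n j \<subseteq> ?A \<times> (UNIV :: 'a set)"
  proof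
    fix p :: "real \<times> 'a" assume "p \<in> slice T n j"
    then have p: "fst p \<in> {0..T}" "nat \<lfloor>real n * fst p / T\<rfloor> = j"
      by (auto simp: slice_def space_phase)
    have "0 \<le> real n * fst p / T" using p(1) T_pos by simp
    then have "real j \<le> real n * fst p / T" "real n * fst p / T < real j + 1"
      using p(2) by linarith+
    then have "T * real j / real n \<le> fst p" "fst p < T * (real j + 1) / real n"
      using T_pos assms by (simp_all add: field_simps)
    with p(1) show "p \<in> ?A \<times> UNIV" by (simp add: mem_Times_iff)
  qed
  have "?A \<times> (UNIV :: 'a set) \<in> sets (phase T)"
    unfolding phase_def by (intro pair_measureI) (auto simp: sets_restrict_space)
  then have "emeasure \<rho> (slice T n j) \<le> emeasure \<rho> (?A \<times> UNIV)"
    using sub by (intro emeasure_mono) simp_all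
  also have "\<dots> = emeasure lborel ?A * emeasure \<pi> UNIV"
    by (rule emeasure_strip) auto
  also have "\<dots> \<le> ennreal (T / real n) * emeasure \<pi> UNIV"
  proof (rule mult_right_mono)
    have "emeasure lborel ?A \<le> emeasure lborel {T * real j / real n ..< T * (real j + 1) / real n}"
      by (intro emeasure_mono) auto
    also have "\<dots> = ennreal (T / real n)"
      using T_pos assms by (subst emeasure_lborel_Ico) (auto simp: field_simps intro!: arg_cong[where f=ennreal])
    finally show "emeasure lborel ?A \<le> ennreal (T / real n)" .
  qed simp
  also have "\<dots> = ennreal (1 / real n) * (ennreal T * emeasure \<pi> UNIV)"
    using T_pos by (simp add: mult.assoc[symmetric] ennreal_mult[symmetric])
  also have "\<dots> = ennreal (R / real n)"
    unfolding R[symmetric] by (simp add: ennreal_mult[symmetric] R_def)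
  finally show ?thesis
    by (simp add: rho.emeasure_eq_measure R_def divide_nonneg_nonneg)
qed

text \<open>\<open>Q\<close> is an arbitrary predicate, so its exceptional set is enclosed in the
  measurable intersection of all \<open>A n\<close>, whose probability lies below every
  \<open>u n\<close>.\<close>

lemma AE_of_small:
  assumes A: "\<And>n. A n \<in> sets P" "\<And>n. {\<omega>\<in>configs T. \<not> Q \<omega>} \<subseteq> A n"
    and le: "\<And>n. measure P (A n) \<le> u n" and u: "u \<longlonglongrightarrow> 0"
  shows "AE \<omega> in P. Q \<omega>"
proof -
  have N: "(\<Inter>n. A n) \<in> sets P" using A(1) by (intro sets.countable_INT) auto
  have "measure P (\<Inter>n. A n) \<le> u m" for m
    by (rule order_trans[OF P.finite_measure_mono le[of m]]) (use A(1) in auto)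
  then have "measure P (\<Inter>n. A n) \<le> 0"
    by (intro LIMSEQ_le_const[OF u]) auto
  then have "measure P (\<Inter>n. A n) = 0" using measure_nonneg[of P "\<Inter>n. A n"] by linarith
  then have "(\<Inter>n. A n) \<in> null_sets P"
    using N by (simp add: null_sets_def P.emeasure_eq_measure)
  then show ?thesis
    by (rule AE_I') (use A(2) in auto)
qed

definition crowded :: "nat \<Rightarrow> (real \<times> 'a) measure set" where
  "crowded n = (\<Union>j\<le>n. {\<omega>\<in>configs T. \<not> emeasure \<omega> (slice T n j) \<le> 1})"

lemma crowded_sets: "crowded n \<in> sets (config_space T)"
  unfolding crowded_def by (intro sets.finite_UN multiple_in_sets slice_sets) simp_all

lemma measure_crowded:
  assumes "0 < n"
  shows "measure P (crowded n) \<le> real (Suc n) * (R / real n)\<^sup>2"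
proof -
  have "measure P (crowded n) \<le> (\<Sum>j\<le>n. measure P {\<omega>\<in>configs T. \<not> emeasure \<omega> (slice T n j) \<le> 1})"
    unfolding crowded_def using multiple_in_sets[OF slice_sets]
    by (intro P.finite_measure_subadditive_finite) auto
  also have "\<dots> \<le> (\<Sum>j\<le>n. (R / real n)\<^sup>2)"
  proof (rule sum_mono)
    fix j
    have "measure P {\<omega>\<in>configs T. \<not> emeasure \<omega> (slice T n j) \<le> 1} \<le> (measure \<rho> (slice T n j))\<^sup>2"
      by (rule measure_multiple[OF slice_sets])
    also have "\<dots> \<le> (R / real n)\<^sup>2"
      using measure_slice[OF assms] by (intro power_mono) simp_all
    finally show "measure P {\<omega>\<in>configs T. \<not> emeasure \<omega> (slice T n j) \<le> 1} \<le> (R / real n)\<^sup>2" .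
  qed
  also have "\<dots> = real (Suc n) * (R / real n)\<^sup>2" by simp
  finally show ?thesis .
qed

lemma not_separated: "\<omega> \<in> configs T \<Longrightarrow> \<not> separated T \<omega> \<Longrightarrow> \<omega> \<in> crowded n"
  by (auto simp: separated_def crowded_def)

lemma AE_separated: "AE \<omega> in P. separated T \<omega>"
proof (rule AE_of_small[of "\<lambda>n. crowded (Suc n)"])
  show "(\<lambda>n. real (Suc (Suc n)) * (R / real (Suc n))\<^sup>2) \<longlonglongrightarrow> 0" by (rule crowding_bound_tendsto_0)
  show "measure P (crowded (Suc n)) \<le> real (Suc (Suc n)) * (R / real (Suc n))\<^sup>2" for n
    by (rule measure_crowded) simp
qed (use not_separated crowded_sets in auto)

text \<open>At level \<open>n\<close>, inserting \<open>p\<close> can spoil separation only if the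
  configuration was crowded already or has a point in the slice \<open>S n\<close> of
  \<open>p\<close>. The latter has probability \<open>1 - exp (- measure \<rho> (S n))\<close>, at
  most \<open>R / n\<close> for positive \<open>n\<close>.\<close>

lemma AE_separated_tau_insert:
  assumes p: "p \<in> space (phase T)"
  shows "AE \<omega> in P. separated T (tau_insert p \<omega>)"
proof -
  define S :: "nat \<Rightarrow> (real \<times> 'a) set" where "S n = slice T n (nat \<lfloor>real n * fst p / T\<rfloor>)" for n
  have S [measurable]: "S n \<in> sets (phase T)" for n unfolding S_def by (rule slice_sets)
  have "void T (S n) \<in> sets P" for n using void_in_config_space[OF S] by simp
  note V = this
  have V_eq: "measure P (configs T - void T (S n)) = 1 - exp (- measure \<rho> (S n))" for n
    using P.prob_compl[OF V] by (simp add: measure_void[OF S])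
  show ?thesis
  proof (rule AE_of_small[of "\<lambda>n. crowded (Suc n) \<union> (configs T - void T (S (Suc n)))"])
    fix n
    show "crowded (Suc n) \<union> (configs T - void T (S (Suc n))) \<in> sets P"
      using crowded_sets V[of "Suc n"] sets.compl_sets[OF V[of "Suc n"]] by (simp add: sets.Un)
    have "\<omega> \<in> crowded (Suc n)"
      if \<omega>: "\<omega> \<in> configs T" "\<not> separated T (tau_insert p \<omega>)" "\<omega> \<in> void T (S (Suc n))" for \<omega>
    proof -
      have "tau_insert p \<omega> \<in> crowded (Suc n)" using \<omega> p by (intro not_separated tau_insert_in_configs)
      then obtain j where j: "j \<le> Suc n" "\<not> emeasure (tau_insert p \<omega>) (slice T (Suc n) j) \<le> 1"
        by (auto simp: crowded_def)
      have eq: "emeasure (tau_insert p \<omega>) (slice T (Suc n) j)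
          = emeasure \<omega> (slice T (Suc n) j \<inter> ({..<fst p} \<times> UNIV)) + indicator (slice T (Suc n) j) p"
        by (rule emeasure_tau_insert[OF \<omega>(1) p slice_sets])
      have le: "emeasure \<omega> (slice T (Suc n) j \<inter> ({..<fst p} \<times> UNIV)) \<le> emeasure \<omega> (slice T (Suc n) j)"
        by (intro emeasure_mono) (simp_all add: sets_configs[OF \<omega>(1)] slice_sets)
      show ?thesis
      proof (cases "p \<in> slice T (Suc n) j")
        case True
        then have "slice T (Suc n) j = S (Suc n)" by (simp add: slice_def S_def)
        then have "emeasure \<omega> (slice T (Suc n) j) = 0" using \<omega>(3) by (simp add: void_def)
        with le eq j(2) True show ?thesis by simp
      next
        case False
        then have "emeasure (tau_insert p \<omega>) (slice T (Suc n) j) \<le> emeasure \<omega> (slice T (Suc n) j)"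
          using le eq by simp
        with j(2) have "\<not> emeasure \<omega> (slice T (Suc n) j) \<le> 1" by (metis order_trans)
        then show ?thesis using j(1) \<omega>(1) by (auto simp: crowded_def)
      qed
    qed
    then show "{\<omega> \<in> configs T. \<not> separated T (tau_insert p \<omega>)} \<subseteq> crowded (Suc n) \<union> (configs T - void T (S (Suc n)))"
      by blast
    have "measure P (crowded (Suc n) \<union> (configs T - void T (S (Suc n))))
        \<le> measure P (crowded (Suc n)) + measure P (configs T - void T (S (Suc n)))"
      using crowded_sets sets.compl_sets[OF V[of "Suc n"]] by (intro measure_Un_le) simp_all
    also have "\<dots> \<le> real (Suc (Suc n)) * (R / real (Suc n))\<^sup>2 + R / real (Suc n)"
    proof (rule add_mono)
      show "measure P (crowded (Suc n)) \<le> real (Suc (Suc n)) * (R / real (Suc n))\<^sup>2"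
        by (rule measure_crowded) simp
      have "measure P (configs T - void T (S (Suc n))) \<le> measure \<rho> (S (Suc n))"
        unfolding V_eq using exp_ge_add_one_self[of "- measure \<rho> (S (Suc n))"] by simp
      also have "\<dots> \<le> R / real (Suc n)" unfolding S_def by (rule measure_slice) simp
      finally show "measure P (configs T - void T (S (Suc n))) \<le> R / real (Suc n)" .
    qed
    finally show "measure P (crowded (Suc n) \<union> (configs T - void T (S (Suc n))))
      \<le> real (Suc (Suc n)) * (R / real (Suc n))\<^sup>2 + R / real (Suc n)" .
  next
    show "(\<lambda>n. real (Suc (Suc n)) * (R / real (Suc n))\<^sup>2 + R / real (Suc n)) \<longlonglongrightarrow> 0"
      by (rule crowding_bound_tendsto_0)
  qed
qed

section \<open>Laws of the past, with and without an added point\<close>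

definition \<phi> :: "(real \<times> 'a) set \<Rightarrow> real \<Rightarrow> real" where
  "\<phi> G t = measure \<rho> (G \<inter> ({..<t} \<times> UNIV))"

definition late :: "real \<Rightarrow> (real \<times> 'a) set" where
  "late t = space (phase T) - {..<t} \<times> UNIV"

lemma late_sets: "late t \<in> sets (phase T)"
proof -
  have "late t = space (phase T) - ({..<t} \<times> UNIV) \<inter> space (phase T)" by (auto simp: late_def)
  then show ?thesis using sets.compl_sets[OF early_sets] by simp
qed

lemma \<phi>_mono:
  assumes "G \<in> sets (phase T)"
  shows "mono (\<phi> G)"
  unfolding \<phi>_def using early_Int_sets[OF assms]
  by (intro monoI rho.finite_measure_mono) auto

lemma \<phi>_measurable: "G \<in> sets (phase T) \<Longrightarrow> (\<lambda>p. \<phi> G (fst p)) \<in> borel_measurable (phase T)"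
  by (rule measurable_compose[OF measurable_fst_phase borel_measurable_mono[OF \<phi>_mono]])

lemma \<phi>_le: "G \<in> sets (phase T) \<Longrightarrow> \<phi> G t \<le> measure \<rho> G"
  unfolding \<phi>_def by (auto intro!: rho.finite_measure_mono)

lemma measure_late: "measure \<rho> (late t) = R - \<phi> (space (phase T)) t"
proof -
  have "measure \<rho> (space \<rho> - space (phase T) \<inter> ({..<t} \<times> UNIV)) = measure \<rho> (space \<rho>) - \<phi> (space (phase T)) t"
    unfolding \<phi>_def by (rule rho.finite_measure_compl) (simp add: early_Int_sets)
  moreover have "space \<rho> - space (phase T) \<inter> ({..<t} \<times> UNIV) = late t" by (auto simp: late_def)
  ultimately show ?thesis by (simp add: R_def)
qed

text \<open>The chain rule for \<open>exp \<circ> \<phi>\<close>, whose density is only measurable: on each slice both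
  \<open>\<integral> exp \<phi>\<close> and the increment of \<open>exp \<phi>\<close> lie between the same two bounds.\<close>

lemma integral_exp_\<phi>:
  assumes G: "G \<in> sets (phase T)"
  shows "(\<integral>p. indicator G p * exp (\<phi> G (fst p)) \<partial>\<rho>) = exp (measure \<rho> G) - 1"
    and "integrable \<rho> (\<lambda>p. indicator G p * exp (\<phi> G (fst p)))"
proof -
  let ?g = "measure \<rho> G"
  have int: "integrable \<rho> (\<lambda>p. indicator H p * exp (\<phi> G (fst p)))" if "H \<in> sets (phase T)" for H
  proof (rule rho.integrable_const_bound[of _ "exp ?g"])
    show "AE p in \<rho>. norm (indicator H p * exp (\<phi> G (fst p))) \<le> exp ?g"
      using \<phi>_le[OF G] by (intro AE_I2) (auto split: split_indicator)
    have [measurable]: "(\<lambda>p. \<phi> G (fst p)) \<in> borel_measurable (phase T)" by (rule \<phi>_measurable[OF G])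
    show "(\<lambda>p. indicator H p * exp (\<phi> G (fst p))) \<in> borel_measurable \<rho>"
      using that by measurable
  qed
  from int[OF G] show "integrable \<rho> (\<lambda>p. indicator G p * exp (\<phi> G (fst p)))" .
  let ?I = "\<integral>p. indicator G p * exp (\<phi> G (fst p)) \<partial>\<rho>"
  have bound: "\<bar>?I - (exp ?g - 1)\<bar> \<le> R / real n * (exp ?g - 1)" if n: "0 < n" for n
  proof -
    define pre :: "nat \<Rightarrow> (real \<times> 'a) set" where "pre j = {p \<in> space (phase T). nat \<lfloor>real n * fst p / T\<rfloor> < j}" for j
    define a where "a j = measure \<rho> (G \<inter> slice T n j)" for j
    define b where "b j = measure \<rho> (G \<inter> pre j)" for j
    define I where "I j = (\<integral>p. indicator (G \<inter> slice T n j) p * exp (\<phi> G (fst p)) \<partial>\<rho>)" for j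
    have pre_sets: "pre j \<in> sets (phase T)" for j unfolding pre_def by measurable
    have GS: "G \<inter> slice T n j \<in> sets (phase T)" for j using G slice_sets by (rule sets.Int)
    have G_sub: "G \<subseteq> space (phase T)" by (rule sets.sets_into_space[OF G])
    have b_Suc: "b (Suc j) = b j + a j" for j
    proof -
      have "G \<inter> pre (Suc j) = (G \<inter> pre j) \<union> (G \<inter> slice T n j)"
        unfolding pre_def slice_def less_Suc_eq by blast
      moreover have "(G \<inter> pre j) \<inter> (G \<inter> slice T n j) = {}"
        unfolding pre_def slice_def by blast
      ultimately show ?thesis
        unfolding a_def b_def using G pre_sets GS
        by (simp add: rho.finite_measure_Union sets.Int)
    qed
    have b_0: "b 0 = 0" by (simp add: b_def pre_def)
    have "G \<inter> pre (Suc n) = G"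
      using G_sub slice_index_le[OF T_pos] unfolding pre_def less_Suc_eq_le by blast
    then have b_end: "b (Suc n) = ?g" by (simp add: b_def)
    have a_nonneg: "0 \<le> a j" for j by (simp add: a_def)
    have a_le: "a j \<le> R / real n" for j
    proof -
      have "a j \<le> measure \<rho> (slice T n j)"
        unfolding a_def by (intro rho.finite_measure_mono) (simp_all add: slice_sets)
      then show ?thesis using measure_slice[OF n, of j] by linarith
    qed
    have between: "b j \<le> \<phi> G (fst p)" "\<phi> G (fst p) \<le> b (Suc j)" if p: "p \<in> slice T n j" for p :: "real \<times> 'a" and j
    proof -
      have floor_mono': "nat \<lfloor>real n * s / T\<rfloor> \<le> nat \<lfloor>real n * t / T\<rfloor>" if "s \<le> t" for s t
        using that T_pos by (intro nat_mono floor_mono divide_right_mono mult_left_mono) auto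
      have "G \<inter> pre j \<subseteq> G \<inter> ({..<fst p} \<times> UNIV)"
      proof
        fix q assume q: "q \<in> G \<inter> pre j"
        have "fst q < fst p"
        proof (rule ccontr)
          assume "\<not> fst q < fst p"
          with floor_mono'[of "fst p" "fst q"] p q show False by (simp add: slice_def pre_def)
        qed
        with q show "q \<in> G \<inter> ({..<fst p} \<times> UNIV)" by (simp add: mem_Times_iff)
      qed
      then show "b j \<le> \<phi> G (fst p)"
        unfolding b_def \<phi>_def using early_Int_sets[OF G] by (intro rho.finite_measure_mono) simp_all
      have "G \<inter> ({..<fst p} \<times> UNIV) \<subseteq> G \<inter> pre (Suc j)"
      proof
        fix q assume q: "q \<in> G \<inter> ({..<fst p} \<times> UNIV)"
        then have "nat \<lfloor>real n * fst q / T\<rfloor> \<le> j"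
          using floor_mono'[of "fst q" "fst p"] p by (simp add: mem_Times_iff slice_def)
        with q G_sub show "q \<in> G \<inter> pre (Suc j)" by (auto simp: pre_def)
      qed
      then show "\<phi> G (fst p) \<le> b (Suc j)"
        unfolding b_def \<phi>_def using G pre_sets by (intro rho.finite_measure_mono) (simp_all add: sets.Int)
    qed
    have integral_const: "(\<integral>p. indicator (G \<inter> slice T n j) p * c \<partial>\<rho>) = a j * c" for j and c :: real
      using GS by (simp add: a_def)
    have int_const: "integrable \<rho> (\<lambda>p. indicator (G \<inter> slice T n j) p * c)" for j and c :: real
      using GS by (intro integrable_mult_left integrable_real_indicator) (simp_all add: less_top[symmetric])
    have lower: "a j * exp (b j) \<le> I j" and upper: "I j \<le> a j * exp (b (Suc j))" for j
    proof -
      show "a j * exp (b j) \<le> I j"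
        unfolding I_def integral_const[symmetric] using between(1)
        by (intro integral_mono int_const int[OF GS]) (simp split: split_indicator)
      show "I j \<le> a j * exp (b (Suc j))"
        unfolding I_def integral_const[symmetric] using between(2)
        by (intro integral_mono int_const int[OF GS]) (simp split: split_indicator)
    qed
    \<comment> \<open>By 1 + a \<le> exp a and 1 - a \<le> exp (- a), the increment of the
      exponential lies between \<open>a j * exp (b j)\<close> and
      \<open>a j * exp (b (Suc j))\<close>, as does \<open>I j\<close>. The gap is
      \<open>a j \<le> R / n\<close> times that increment, so the errors telescope to a total of
      order 1 / n.\<close>
    have step: "\<bar>I j - (exp (b (Suc j)) - exp (b j))\<bar> \<le> R / real n * (exp (b (Suc j)) - exp (b j))" for j
    proof -
      have "exp (b j) * (1 + a j) \<le> exp (b j) * exp (a j)"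
        using exp_ge_add_one_self by (intro mult_left_mono) auto
      then have l: "a j * exp (b j) \<le> exp (b (Suc j)) - exp (b j)"
        by (simp add: b_Suc exp_add algebra_simps)
      have "exp (b (Suc j)) * (1 - a j) \<le> exp (b (Suc j)) * exp (- a j)"
        using exp_ge_add_one_self[of "- a j"] by (intro mult_left_mono) auto
      also have "\<dots> = exp (b j)" by (simp add: b_Suc exp_add[symmetric])
      finally have u: "exp (b (Suc j)) - exp (b j) \<le> a j * exp (b (Suc j))"
        by (simp add: algebra_simps)
      have "\<bar>I j - (exp (b (Suc j)) - exp (b j))\<bar> \<le> a j * exp (b (Suc j)) - a j * exp (b j)"
        using lower[of j] upper[of j] l u by linarith
      also have "\<dots> = a j * (exp (b (Suc j)) - exp (b j))" by (simp add: algebra_simps)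
      also have "\<dots> \<le> R / real n * (exp (b (Suc j)) - exp (b j))"
        using a_le[of j] a_nonneg[of j] by (intro mult_right_mono) (simp_all add: b_Suc)
      finally show ?thesis .
    qed
    have "?I = (\<integral>p. (\<Sum>j\<le>n. indicator (G \<inter> slice T n j) p * exp (\<phi> G (fst p))) \<partial>\<rho>)"
    proof (rule Bochner_Integration.integral_cong[OF refl])
      fix p assume "p \<in> space \<rho>"
      then have p: "p \<in> space (phase T)" by simp
      have "(\<Sum>j\<le>n. indicator (G \<inter> slice T n j) p * exp (\<phi> G (fst p)))
          = (\<Sum>j\<le>n. if j = nat \<lfloor>real n * fst p / T\<rfloor> then indicator G p * exp (\<phi> G (fst p)) else 0)"
        using p by (intro sum.cong) (auto simp: slice_def split: split_indicator)
      also have "\<dots> = indicator G p * exp (\<phi> G (fst p))"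
        using slice_index_le[OF T_pos p, of n] by (simp add: sum.delta)
      finally show "indicator G p * exp (\<phi> G (fst p)) = (\<Sum>j\<le>n. indicator (G \<inter> slice T n j) p * exp (\<phi> G (fst p)))" ..
    qed
    also have "\<dots> = (\<Sum>j\<le>n. I j)"
      unfolding I_def by (rule Bochner_Integration.integral_sum) (rule int[OF GS])
    finally have "?I = (\<Sum>j\<le>n. I j)" .
    moreover have tele: "(\<Sum>j\<le>n. exp (b (Suc j)) - exp (b j)) = exp ?g - 1"
      by (simp add: sum_lessThan_telescope[of "\<lambda>j. exp (b j)" "Suc n", unfolded lessThan_Suc_atMost] b_0 b_end)
    ultimately have "\<bar>?I - (exp ?g - 1)\<bar> = \<bar>\<Sum>j\<le>n. I j - (exp (b (Suc j)) - exp (b j))\<bar>"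
      by (simp only: sum_subtractf)
    also have "\<dots> \<le> (\<Sum>j\<le>n. \<bar>I j - (exp (b (Suc j)) - exp (b j))\<bar>)" by (rule sum_abs)
    also have "\<dots> \<le> (\<Sum>j\<le>n. R / real n * (exp (b (Suc j)) - exp (b j)))" by (intro sum_mono step)
    also have "\<dots> = R / real n * (exp ?g - 1)" by (simp only: sum_distrib_left[symmetric] tele)
    finally show ?thesis .
  qed
  have "(\<lambda>n. 1 / real (Suc n)) \<longlonglongrightarrow> 0" by real_asymp
  from tendsto_mult_left_zero[OF this, of "R * (exp ?g - 1)"]
  have lim: "(\<lambda>n. R / real (Suc n) * (exp ?g - 1)) \<longlonglongrightarrow> 0" by simp
  have "\<bar>?I - (exp ?g - 1)\<bar> \<le> 0"
    by (intro LIMSEQ_le_const[OF lim] exI[of _ 0] allI impI bound) simp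
  then show "?I = exp ?g - 1" by simp
qed

lemma measure_early_late:
  assumes "E \<in> sets (phase T)"
  shows "measure \<rho> (late t \<union> E) = measure \<rho> (late t) + \<phi> E t"
proof -
  have "late t \<union> E = late t \<union> (E \<inter> ({..<t} \<times> UNIV))"
    using sets.sets_into_space[OF assms] by (auto simp: late_def)
  moreover have "measure \<rho> (late t \<union> (E \<inter> ({..<t} \<times> UNIV))) = measure \<rho> (late t) + \<phi> E t"
    unfolding \<phi>_def using late_sets early_Int_sets[OF assms]
    by (intro rho.finite_measure_Union) (auto simp: late_def)
  ultimately show ?thesis by simp
qed

text \<open>\<open>tau t\<close> maps the Poisson law to its conditional law given that there is no point after
  time \<open>t\<close>.\<close>

lemma nn_integral_tau_le:
  fixes p :: "real \<times> 'a"
  assumes p: "p \<in> space (phase T)" and f: "f \<in> borel_measurable (config_space T)"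
  shows "(\<integral>\<^sup>+\<omega>. f (tau (fst p) \<omega>) \<partial>P) \<le> ennreal (exp R) * (\<integral>\<^sup>+\<omega>. f \<omega> \<partial>P)"
proof -
  define t where "t = fst p"
  have t: "0 \<le> t" using p by (auto simp: t_def space_phase)
  \<comment> \<open>\<open>c\<close> is the probability of no point from time \<open>t\<close> on.
    Instead of conditioning on that event, the restriction of \<open>P\<close> to it is compared
    with \<open>c\<close> times the image of \<open>P\<close>.\<close>
  define c where "c = ennreal (exp (- measure \<rho> (late t)))"
  define D where "D = void T (late t)"
  define \<mu> where "\<mu> = distr (density P (indicator D)) (config_space T) (\<lambda>\<omega>. \<omega>)"
  define \<nu> where "\<nu> = distr (density P (\<lambda>_. c)) (config_space T) (tau t)"
  have D: "D \<in> sets (config_space T)" unfolding D_def by (rule void_in_config_space[OF late_sets])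
  have tau_m: "tau t \<in> measurable (config_space T) (config_space T :: (real \<times> 'a) measure measure)"
    unfolding t_def by (rule measurable_section_tau(1)[OF p])
  have ind_m: "indicator D \<in> borel_measurable P" using D by simp
  have id_m: "(\<lambda>\<omega>. \<omega>) \<in> measurable P (config_space T)" and tau_m': "tau t \<in> measurable P (config_space T)"
    using tau_m by (simp_all cong: measurable_cong_sets)
  have void_\<mu>: "emeasure \<mu> (void T E) = ennreal (exp (- measure \<rho> (late t \<union> E)))" if E: "E \<in> sets (phase T)" for E
  proof -
    have "emeasure \<mu> (void T E) = (\<integral>\<^sup>+\<omega>. indicator D \<omega> * indicator (void T E) \<omega> \<partial>P)"
      unfolding \<mu>_def using ind_m id_m void_in_config_space[OF E] by (intro emeasure_distr_density)
    also have "\<dots> = (\<integral>\<^sup>+\<omega>. indicator (void T (late t \<union> E)) \<omega> \<partial>P)"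
    proof (rule nn_integral_cong)
      fix \<omega> assume "\<omega> \<in> space P"
      then have "\<omega> \<in> configs T" by simp
      then show "indicator D \<omega> * indicator (void T E) \<omega> = (indicator (void T (late t \<union> E)) \<omega> :: ennreal)"
        using E late_sets[of t] by (simp add: D_def void_def indicator_def emeasure_Un_eq_0 sets_configs)
    qed
    also have "\<dots> = ennreal (exp (- measure \<rho> (late t \<union> E)))"
      using E late_sets by (subst nn_integral_indicator) (simp_all add: void_in_config_space emeasure_void sets.Un)
    finally show ?thesis .
  qed
  have void_\<nu>: "emeasure \<nu> (void T E) = ennreal (exp (- measure \<rho> (late t \<union> E)))" if E: "E \<in> sets (phase T)" for E
  proof -
    have "emeasure \<nu> (void T E) = (\<integral>\<^sup>+\<omega>. c * indicator (void T E) (tau t \<omega>) \<partial>P)"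
      unfolding \<nu>_def using void_in_config_space[OF E] tau_m' by (intro emeasure_distr_density) simp_all
    also have "\<dots> = (\<integral>\<^sup>+\<omega>. c * indicator (void T (E \<inter> ({..<t} \<times> UNIV))) \<omega> \<partial>P)"
    proof (rule nn_integral_cong)
      fix \<omega> assume "\<omega> \<in> space P"
      then have "\<omega> \<in> configs T" by simp
      then show "c * indicator (void T E) (tau t \<omega>) = c * indicator (void T (E \<inter> ({..<t} \<times> UNIV))) \<omega>"
        using tau_in_configs[of \<omega> T t] t by (simp add: void_def indicator_def emeasure_tau[OF _ t E])
    qed
    also have "\<dots> = c * ennreal (exp (- \<phi> E t))"
      using early_Int_sets[OF E] by (subst nn_integral_cmult_indicator)
        (simp_all add: void_in_config_space emeasure_void \<phi>_def)
    also have "\<dots> = ennreal (exp (- measure \<rho> (late t \<union> E)))"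
      unfolding measure_early_late[OF E] c_def
      by (subst ennreal_mult[symmetric]) (simp_all add: exp_add[symmetric])
    finally show ?thesis .
  qed
  have "\<mu> = \<nu>"
  proof (rule void_probabilities_unique[OF T_pos])
    show "emeasure \<mu> (configs T) \<noteq> \<infinity>"
    proof -
      have "configs T = (void T {} :: (real \<times> 'a) measure set)" by (auto simp: void_def)
      then show ?thesis using void_\<mu>[of "{}"] by simp
    qed
    have "AE \<omega> in density P (indicator D). separated T \<omega>"
      unfolding AE_density[OF ind_m] by (rule eventually_mono[OF AE_separated]) simp
    then show "AE \<omega> in \<mu>. separated T \<omega>"
      unfolding \<mu>_def using separated_in_config_space id_m by (subst AE_distr_iff) simp_all
    show "AE \<omega> in \<nu>. separated T \<omega>"
      unfolding \<nu>_def using separated_in_config_space tau_m'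
      by (subst AE_distr_iff) (auto simp: AE_density intro!: eventually_mono[OF AE_separated] separated_tau t)
  qed (simp_all add: \<mu>_def \<nu>_def void_\<mu>[unfolded \<mu>_def] void_\<nu>[unfolded \<nu>_def])
  have "(\<integral>\<^sup>+\<omega>. f (tau t \<omega>) \<partial>P) = ennreal (exp (measure \<rho> (late t))) * (c * (\<integral>\<^sup>+\<omega>. f (tau t \<omega>) \<partial>P))"
    unfolding c_def mult.assoc[symmetric] by (subst ennreal_mult[symmetric]) (simp_all add: exp_add[symmetric])
  also have "c * (\<integral>\<^sup>+\<omega>. f (tau t \<omega>) \<partial>P) = (\<integral>\<^sup>+\<omega>. f \<omega> \<partial>\<nu>)"
    unfolding \<nu>_def using measurable_compose[OF tau_m' f]
    by (subst nn_integral_distr_density[OF tau_m' _ f]) (simp_all add: nn_integral_cmult)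
  also have "\<dots> = (\<integral>\<^sup>+\<omega>. indicator D \<omega> * f \<omega> \<partial>P)"
    unfolding \<open>\<mu> = \<nu>\<close>[symmetric] \<mu>_def
    by (rule nn_integral_distr_density[OF id_m ind_m f])
  also have "\<dots> \<le> (\<integral>\<^sup>+\<omega>. f \<omega> \<partial>P)"
    by (intro nn_integral_mono) (simp split: split_indicator)
  \<comment> \<open>Undoing the weight \<open>c\<close> costs a factor that depends on
    \<open>t\<close>; bounding \<open>late t\<close> by the total mass makes the estimate uniform in
    \<open>p\<close>.\<close>
  also have "ennreal (exp (measure \<rho> (late t))) \<le> ennreal (exp R)"
    by (intro ennreal_leI) (simp add: rho_le_R)
  finally show ?thesis unfolding t_def by (simp add: mult_left_mono mult_right_mono)
qed

text \<open>The last point \<open>p\<close> of a nonempty configuration and the configuration before \<open>p\<close> have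
  joint density \<open>exp (- \<rho> (late (fst p)))\<close> with respect to \<open>\<rho> \<otimes> P\<close>.\<close>

lemma nn_integral_tau_insert_le:
  assumes f: "f \<in> borel_measurable (config_space T)"
  shows "(\<integral>\<^sup>+x. f (tau_insert (fst x) (snd x)) \<partial>(\<rho> \<Otimes>\<^sub>M P)) \<le> ennreal (exp R) * (\<integral>\<^sup>+\<omega>. f \<omega> \<partial>P)"
proof -
  let ?S = "space (phase T) :: (real \<times> 'a) set"
  define w where "w p = ennreal (exp (- measure \<rho> (late (fst p))))" for p :: "real \<times> 'a"
  define J where "J x = tau_insert (fst x) (snd x)" for x :: "(real \<times> 'a) \<times> (real \<times> 'a) measure"
  \<comment> \<open>Only a nonempty configuration has a last point, so the empty one is removed.
    This is the source of the term \<open>exp (- R)\<close> subtracted in the void probabilities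
    below.\<close>
  define D where "D = configs T - void T ?S"
  define \<mu> where "\<mu> = distr (density P (indicator D)) (config_space T) (\<lambda>\<omega>. \<omega>)"
  define \<nu> where "\<nu> = distr (density (\<rho> \<Otimes>\<^sub>M P) (\<lambda>x. w (fst x))) (config_space T) J"
  have voids: "void T ?S \<in> sets P" using void_in_config_space[of ?S T] by simp
  have D: "D \<in> sets P" using sets.compl_sets[OF voids] by (simp add: D_def)
  have ind_m: "indicator D \<in> borel_measurable P" using D by (rule borel_measurable_indicator)
  have id_m: "(\<lambda>\<omega>. \<omega>) \<in> measurable P (config_space T)" by (simp cong: measurable_cong_sets)
  have [measurable]: "(\<lambda>p. \<phi> ?S (fst p)) \<in> borel_measurable (phase T)" by (intro \<phi>_measurable sets.top)
  have w_m [measurable]: "w \<in> borel_measurable \<rho>" unfolding w_def measure_late by measurable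
  have J_m [measurable]: "J \<in> measurable (\<rho> \<Otimes>\<^sub>M P) (config_space T)"
  proof -
    have "sets (\<rho> \<Otimes>\<^sub>M P) = sets (phase T \<Otimes>\<^sub>M config_space T)" by (intro sets_pair_measure_cong) simp_all
    then show ?thesis using measurable_tau_tau_insert(2)[of T] unfolding J_def by (simp cong: measurable_cong_sets)
  qed
  have wf_m: "(\<lambda>x. w (fst x)) \<in> borel_measurable (\<rho> \<Otimes>\<^sub>M P)" by measurable
  have void_\<mu>: "emeasure \<mu> (void T E) = ennreal (exp (- measure \<rho> E) - exp (- R))" if E: "E \<in> sets (phase T)" for E
  proof -
    have E_sub: "E \<subseteq> ?S" by (rule sets.sets_into_space[OF E])
    have sub: "void T ?S \<subseteq> void T E"
    proof -
      have "emeasure \<omega> E = 0" if "\<omega> \<in> configs T" "emeasure \<omega> ?S = 0" for \<omega>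
        using emeasure_mono[OF E_sub, of \<omega>] that by (simp add: sets_configs)
      then show ?thesis by (auto simp: void_def)
    qed
    have vE: "void T E \<in> sets P" using void_in_config_space[OF E] by simp
    have "emeasure \<mu> (void T E) = (\<integral>\<^sup>+\<omega>. indicator D \<omega> * indicator (void T E) \<omega> \<partial>P)"
      unfolding \<mu>_def using ind_m id_m void_in_config_space[OF E] by (intro emeasure_distr_density)
    also have "\<dots> = (\<integral>\<^sup>+\<omega>. indicator (void T E - void T ?S) \<omega> \<partial>P)"
      by (intro nn_integral_cong) (auto simp: D_def void_def split: split_indicator)
    also have "\<dots> = ennreal (measure P (void T E - void T ?S))"
      using vE voids by (subst nn_integral_indicator) (simp_all add: P.emeasure_eq_measure sets.Diff del: sets_P)
    also have "measure P (void T E - void T ?S) = exp (- measure \<rho> E) - exp (- R)"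
      using P.finite_measure_Diff[OF vE voids sub] E by (simp add: measure_void R_def)
    finally show ?thesis .
  qed
  have void_\<nu>: "emeasure \<nu> (void T E) = ennreal (exp (- measure \<rho> E) - exp (- R))" if E: "E \<in> sets (phase T)" for E
  proof -
    \<comment> \<open>For the new configuration to avoid \<open>E\<close>, the inserted point must
      fall in \<open>G\<close> and the past must be void on the part of \<open>E\<close> before
      it.\<close>
    define G where "G = ?S - E"
    have G: "G \<in> sets (phase T)" unfolding G_def using E by (rule sets.compl_sets)
    have E_sub: "E \<subseteq> ?S" by (rule sets.sets_into_space[OF E])
    have measure_G: "measure \<rho> G = R - measure \<rho> E"
      using rho.finite_measure_compl[of E] E by (simp add: G_def R_def)
    have vE: "void T E \<in> sets (config_space T)" by (rule void_in_config_space[OF E])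
    note vE [measurable]
    \<comment> \<open>The late region and the early part of \<open>E\<close> together miss exactly
      the early part of \<open>G\<close>. The density times the void probability thus becomes
      \<open>exp (- R)\<close> times \<open>exp (\<phi> G t)\<close>, whose integral over
      \<open>G\<close> is known.\<close>
    have exponent: "measure \<rho> (late t) + \<phi> E t = R - \<phi> G t" for t
    proof -
      have "?S \<inter> ({..<t} \<times> UNIV) = (E \<inter> ({..<t} \<times> UNIV)) \<union> (G \<inter> ({..<t} \<times> UNIV))"
        using E_sub by (auto simp: G_def)
      moreover have "(E \<inter> ({..<t} \<times> UNIV)) \<inter> (G \<inter> ({..<t} \<times> UNIV)) = {}" by (auto simp: G_def)
      ultimately have "\<phi> ?S t = \<phi> E t + \<phi> G t"
        unfolding \<phi>_def using early_Int_sets[OF E] early_Int_sets[OF G]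
        by (simp add: rho.finite_measure_Union)
      then show ?thesis by (simp add: measure_late)
    qed
    have inner: "(\<integral>\<^sup>+\<omega>. w p * indicator (void T E) (J (p, \<omega>)) \<partial>P)
        = ennreal (exp (- R)) * ennreal (indicator G p * exp (\<phi> G (fst p)))" if p: "p \<in> ?S" for p
    proof -
      let ?E = "E \<inter> ({..<fst p} \<times> UNIV)"
      have "(\<integral>\<^sup>+\<omega>. w p * indicator (void T E) (J (p, \<omega>)) \<partial>P)
          = (\<integral>\<^sup>+\<omega>. (w p * indicator G p) * indicator (void T ?E) \<omega> \<partial>P)"
      proof (rule nn_integral_cong)
        fix \<omega> assume "\<omega> \<in> space P"
        then have \<omega>: "\<omega> \<in> configs T" by simp
        have "J (p, \<omega>) \<in> void T E \<longleftrightarrow> p \<in> G \<and> \<omega> \<in> void T ?E"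
          using \<omega> p tau_insert_in_configs[OF \<omega> p]
          by (auto simp: J_def void_def emeasure_tau_insert[OF \<omega> p E] G_def split: split_indicator)
        then show "w p * indicator (void T E) (J (p, \<omega>)) = (w p * indicator G p) * indicator (void T ?E) \<omega>"
          by (simp add: indicator_def)
      qed
      also have "\<dots> = (w p * indicator G p) * ennreal (exp (- \<phi> E (fst p)))"
        using early_Int_sets[OF E] by (subst nn_integral_cmult_indicator)
          (simp_all add: void_in_config_space emeasure_void \<phi>_def)
      also have "\<dots> = indicator G p * ennreal (exp (- (measure \<rho> (late (fst p)) + \<phi> E (fst p))))"
        by (simp add: w_def ennreal_mult[symmetric] exp_add[symmetric] mult.commute mult.left_commute split: split_indicator)
      also have "\<dots> = ennreal (exp (- R)) * ennreal (indicator G p * exp (\<phi> G (fst p)))"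
        unfolding exponent by (simp add: ennreal_mult[symmetric] exp_add[symmetric] split: split_indicator)
      finally show ?thesis .
    qed
    have [measurable]: "(\<lambda>p. \<phi> G (fst p)) \<in> borel_measurable (phase T)" by (rule \<phi>_measurable[OF G])
    note G [measurable]
    have "emeasure \<nu> (void T E) = (\<integral>\<^sup>+x. w (fst x) * indicator (void T E) (J x) \<partial>(\<rho> \<Otimes>\<^sub>M P))"
      unfolding \<nu>_def by (intro emeasure_distr_density J_m wf_m vE)
    also have "\<dots> = (\<integral>\<^sup>+p. \<integral>\<^sup>+\<omega>. w (fst (p, \<omega>)) * indicator (void T E) (J (p, \<omega>)) \<partial>P \<partial>\<rho>)"
      by (rule P.nn_integral_fst[symmetric]) measurable
    also have "\<dots> = (\<integral>\<^sup>+p. ennreal (exp (- R)) * ennreal (indicator G p * exp (\<phi> G (fst p))) \<partial>\<rho>)"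
      by (intro nn_integral_cong) (simp add: inner)
    also have "\<dots> = ennreal (exp (- R)) * (\<integral>\<^sup>+p. ennreal (indicator G p * exp (\<phi> G (fst p))) \<partial>\<rho>)"
      by (rule nn_integral_cmult) measurable
    also have "(\<integral>\<^sup>+p. ennreal (indicator G p * exp (\<phi> G (fst p))) \<partial>\<rho>) = ennreal (exp (measure \<rho> G) - 1)"
      unfolding integral_exp_\<phi>(1)[OF G, symmetric]
      by (intro nn_integral_eq_integral integral_exp_\<phi>(2)[OF G]) simp
    also have "ennreal (exp (- R)) * ennreal (exp (measure \<rho> G) - 1) = ennreal (exp (- R) * (exp (measure \<rho> G) - 1))"
      by (rule ennreal_mult[symmetric]) simp_all
    also have "exp (- R) * (exp (measure \<rho> G) - 1) = exp (- measure \<rho> E) - exp (- R)"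
      by (simp add: measure_G algebra_simps exp_add[symmetric])
    finally show ?thesis .
  qed
  have "\<mu> = \<nu>"
  proof (rule void_probabilities_unique[OF T_pos])
    show "emeasure \<mu> (configs T) \<noteq> \<infinity>"
    proof -
      have "configs T = (void T {} :: (real \<times> 'a) measure set)" by (auto simp: void_def)
      then show ?thesis using void_\<mu>[of "{}"] by simp
    qed
    have "AE \<omega> in density P (indicator D). separated T \<omega>"
      unfolding AE_density[OF ind_m] by (rule eventually_mono[OF AE_separated]) simp
    then show "AE \<omega> in \<mu>. separated T \<omega>"
      unfolding \<mu>_def using separated_in_config_space id_m by (subst AE_distr_iff) simp_all
    have "AE x in \<rho> \<Otimes>\<^sub>M P. separated T (J x)"
    proof (rule pair.AE_pair_measure)
      have "J -` {\<omega>\<in>configs T. separated T \<omega>} \<inter> space (\<rho> \<Otimes>\<^sub>M P) \<in> sets (\<rho> \<Otimes>\<^sub>M P)"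
        by (rule measurable_sets[OF J_m separated_in_config_space])
      moreover have "J -` {\<omega>\<in>configs T. separated T \<omega>} \<inter> space (\<rho> \<Otimes>\<^sub>M P) = {x \<in> space (\<rho> \<Otimes>\<^sub>M P). separated T (J x)}"
        by (auto simp: separated_def)
      ultimately show "{x \<in> space (\<rho> \<Otimes>\<^sub>M P). separated T (J x)} \<in> sets (\<rho> \<Otimes>\<^sub>M P)" by simp
      show "AE p in \<rho>. AE \<omega> in P. separated T (J (p, \<omega>))"
      proof (rule AE_I2)
        fix p assume "p \<in> space \<rho>"
        then show "AE \<omega> in P. separated T (J (p, \<omega>))"
          unfolding J_def fst_conv snd_conv by (intro AE_separated_tau_insert) simp
      qed
    qed
    then show "AE \<omega> in \<nu>. separated T \<omega>"
      unfolding \<nu>_def using separated_in_config_space J_m wf_m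
      by (subst AE_distr_iff) (auto simp: AE_density)
  qed (simp_all add: \<mu>_def \<nu>_def void_\<mu>[unfolded \<mu>_def] void_\<nu>[unfolded \<nu>_def])
  have fJ_m: "(\<lambda>x. f (J x)) \<in> borel_measurable (\<rho> \<Otimes>\<^sub>M P)" by (rule measurable_compose[OF J_m f])
  have "(\<integral>\<^sup>+x. f (J x) \<partial>(\<rho> \<Otimes>\<^sub>M P)) \<le> (\<integral>\<^sup>+x. ennreal (exp R) * (w (fst x) * f (J x)) \<partial>(\<rho> \<Otimes>\<^sub>M P))"
  proof (rule nn_integral_mono)
    fix x :: "(real \<times> 'a) \<times> (real \<times> 'a) measure"
    \<comment> \<open>The density \<open>w\<close> is at least \<open>exp (- R)\<close>, since
      \<open>late\<close> has mass at most \<open>R\<close>.\<close>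
    have "1 \<le> ennreal (exp R) * w (fst x)"
      unfolding w_def by (subst ennreal_mult[symmetric]) (simp_all add: exp_add[symmetric] rho_le_R)
    from mult_right_mono[OF this, of "f (J x)"]
    show "f (J x) \<le> ennreal (exp R) * (w (fst x) * f (J x))" by (simp add: mult.assoc)
  qed
  also have "\<dots> = ennreal (exp R) * (\<integral>\<^sup>+x. w (fst x) * f (J x) \<partial>(\<rho> \<Otimes>\<^sub>M P))"
    using fJ_m wf_m by (intro nn_integral_cmult borel_measurable_times_ennreal)
  also have "(\<integral>\<^sup>+x. w (fst x) * f (J x) \<partial>(\<rho> \<Otimes>\<^sub>M P)) = (\<integral>\<^sup>+\<omega>. f \<omega> \<partial>\<nu>)"
    unfolding \<nu>_def by (rule nn_integral_distr_density[OF J_m wf_m f, symmetric])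
  also have "\<dots> = (\<integral>\<^sup>+\<omega>. indicator D \<omega> * f \<omega> \<partial>P)"
    unfolding \<open>\<mu> = \<nu>\<close>[symmetric] \<mu>_def
    by (rule nn_integral_distr_density[OF id_m ind_m f])
  also have "\<dots> \<le> (\<integral>\<^sup>+\<omega>. f \<omega> \<partial>P)"
    by (intro nn_integral_mono) (simp split: split_indicator)
  finally show ?thesis by (simp add: J_def mult_left_mono)
qed

end

section \<open>Pathwise decomposition\<close>

lemma cfg_empty: "cfg T {} x = empty_config T"
  by (rule measure_eqI) (simp_all add: emeasure_cfg)

lemma cfg_cong: "(\<And>j. j \<in> J \<Longrightarrow> x j = y j) \<Longrightarrow> cfg T J x = cfg T J y"
  unfolding cfg_def by (intro distr_cong) simp_all

lemma integral_cfg: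
  fixes f :: "real \<times> 'a::polish_space \<Rightarrow> real"
  assumes "finite J" "x \<in> J \<rightarrow> space (phase T)" "f \<in> borel_measurable (phase T)"
  shows "(\<integral>p. f p \<partial>cfg T J x) = (\<Sum>j\<in>J. f (x j))"
  unfolding cfg_def using assms
  by (subst integral_distr) (simp_all add: lebesgue_integral_count_space_finite)

text \<open>Finiteness comes from \<open>n + 1\<close> slices of mass at most 1. Two indices with
  equal times would fall into the same slice and give it mass at least 2; this also excludes
  repeated points.\<close>

lemma separated_cases:
  assumes g: "separated T \<omega>" and T: "0 < T"
  obtains J x where "finite J" "x \<in> J \<rightarrow> space (phase T)" "\<omega> = cfg T J x"
    "inj_on (\<lambda>j. fst (x j)) J"
proof -
  obtain n where \<omega>: "\<omega> \<in> configs T" and n: "\<And>j. j \<le> n \<Longrightarrow> emeasure \<omega> (slice T n j) \<le> 1"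
    using g by (auto simp: separated_def)
  obtain J x where x: "x \<in> J \<rightarrow> space (phase T)" and eq: "\<omega> = cfg T J x"
    using \<omega> by (rule configs_cases)
  have "emeasure \<omega> (space (phase T)) = (\<Sum>j\<le>n. emeasure \<omega> (space (phase T) \<inter> slice T n j))"
    by (rule emeasure_slices[OF T sets_configs[OF \<omega>] sets.top])
  also have "\<dots> \<le> (\<Sum>j\<le>n. 1)"
    using n by (intro sum_mono) (simp add: sets.Int_space_eq1 slice_sets)
  also have "\<dots> < \<infinity>" by (simp add: of_nat_less_top)
  finally have "emeasure (count_space J) {j\<in>J. x j \<in> space (phase T)} < \<infinity>"
    using x unfolding eq by (simp add: emeasure_cfg)
  moreover have "{j\<in>J. x j \<in> space (phase T)} = J" using x by auto
  ultimately have fin: "finite J"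
    by (metis emeasure_count_space_infinite infinity_ennreal_def less_irrefl order_refl)
  have "inj_on (\<lambda>j. fst (x j)) J"
  proof (rule inj_onI, rule ccontr)
    fix i j assume ij: "i \<in> J" "j \<in> J" "fst (x i) = fst (x j)" "i \<noteq> j"
    define k where "k = nat \<lfloor>real n * fst (x i) / T\<rfloor>"
    have sp: "x i \<in> space (phase T)" "x j \<in> space (phase T)" using ij x by auto
    have "k \<le> n" unfolding k_def by (rule slice_index_le[OF T sp(1)])
    have "{i, j} \<subseteq> {l\<in>J. x l \<in> slice T n k}"
      using ij sp by (simp add: slice_def k_def)
    then have "emeasure (count_space J) {i, j} \<le> emeasure (count_space J) {l\<in>J. x l \<in> slice T n k}"
      by (intro emeasure_mono) simp_all
    also have "\<dots> = emeasure \<omega> (slice T n k)"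
      unfolding eq by (rule emeasure_cfg[OF x slice_sets, symmetric])
    also have "\<dots> \<le> 1" using \<open>k \<le> n\<close> by (rule n)
    finally show False using ij by simp
  qed
  with fin x eq show thesis by (rule that)
qed

lemma op_H_predictable:
  assumes F: "F \<in> borel_measurable (FN T)"
  shows "(\<lambda>((t, \<omega>), x). op_H (t, x) F \<omega>) \<in> borel_measurable (predictable T)"
    (is "?f \<in> _")
proof -
  have m: "(\<lambda>z. F (tau_insert (fst (fst z), snd z) (snd (fst z))) - F (tau (fst (fst z)) (snd (fst z))))
      \<in> borel_measurable (predictable T)"
    by (intro borel_measurable_diff measurable_compose[OF _ F] measurable_tau_tau_insert_predictable)
  have eq: "?f z = F (tau_insert (fst (fst z), snd z) (snd (fst z))) - F (tau (fst (fst z)) (snd (fst z)))"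
    if "z \<in> space (predictable T)" for z
  proof -
    obtain t \<omega> x where z: "z = ((t, \<omega>), x)" by (metis prod.exhaust)
    with that have "\<omega> \<in> configs T" "(t, x) \<in> space (phase T)"
      by (simp_all add: predictable_def space_pair_measure space_phase)
    then show ?thesis by (simp add: z op_H_eq)
  qed
  show ?thesis by (rule iffD2[OF measurable_cong[OF eq] m])
qed

lemma predictable_integrand_measurable:
  assumes Z: "(\<lambda>((t, \<omega>), x). Z (t, x) \<omega>) \<in> borel_measurable (predictable T)"
    and \<omega>: "\<omega> \<in> configs T"
  shows "(\<lambda>p. Z p \<omega>) \<in> borel_measurable (phase T)"
  using measurable_compose[OF predictable_section[OF \<omega>] Z] by simp

text \<open>The induction appends the latest point last. The earlier increments see only the past of
  their own points and are unchanged; the new increment is exactly the change of \<open>F\<close>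
  caused by the new point.\<close>

lemma telescope_cfg:
  fixes x :: "nat \<Rightarrow> real \<times> 'a::polish_space"
  assumes "finite J" "x \<in> J \<rightarrow> space (phase T)" "inj_on (\<lambda>j. fst (x j)) J"
  shows "F (cfg T J x) = F (empty_config T) + (\<Sum>j\<in>J. op_H (x j) F (cfg T J x))"
  using assms
proof (induction J rule: finite_ranking_induct[where f="\<lambda>j. fst (x j)"])
  case empty
  then show ?case by (simp add: cfg_empty)
next
  case (insert k S)
  show ?case
  proof (cases "k \<in> S")
    case True
    then show ?thesis using insert by (simp add: insert_absorb)
  next
    case False
    have x: "x \<in> S \<rightarrow> space (phase T)" "x k \<in> space (phase T)" using insert.prems by auto
    have nonneg: "0 \<le> fst (x j)" if "j \<in> insert k S" for j
      using funcset_mem[OF insert.prems(1) that] by (simp add: space_phase mem_Times_iff)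
    have less: "fst (x j) < fst (x k)" if "j \<in> S" for j
    proof -
      have "fst (x j) \<noteq> fst (x k)"
        using insert.prems(2) that False unfolding inj_on_def by blast
      then show ?thesis using insert.hyps(2)[OF that] by simp
    qed
    have "tau (fst (x k)) (cfg T (insert k S) x) = cfg T {j \<in> insert k S. fst (x j) < fst (x k)} x"
      by (rule tau_cfg[OF insert.prems(1) nonneg]) simp
    also have "{j \<in> insert k S. fst (x j) < fst (x k)} = S" using less by auto
    finally have tau_k: "tau (fst (x k)) (cfg T (insert k S) x) = cfg T S x" .
    have H_k: "op_H (x k) F (cfg T (insert k S) x) = F (cfg T (insert k S) x) - F (cfg T S x)"
      using op_H_eq[OF cfg_in_configs[OF insert.prems(1)] x(2), of F]
        add_dirac_cfg[OF insert.prems(1) False] by (simp add: tau_insert_def tau_k)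
    have H_j: "op_H (x j) F (cfg T (insert k S) x) = op_H (x j) F (cfg T S x)" if j: "j \<in> S" for j
    proof -
      have "{i \<in> insert k S. fst (x i) < fst (x j)} = {i \<in> S. fst (x i) < fst (x j)}"
        using less[OF j] by auto
      then have "tau (fst (x j)) (cfg T (insert k S) x) = tau (fst (x j)) (cfg T S x)"
        using tau_cfg[OF insert.prems(1), of "fst (x j)"] tau_cfg[OF x(1), of "fst (x j)"] nonneg[of j] j by simp
      then show ?thesis by (simp add: op_H_def)
    qed
    have "F (cfg T S x) = F (empty_config T) + (\<Sum>j\<in>S. op_H (x j) F (cfg T S x))"
      using insert.prems(2) by (intro insert.IH x) (auto intro: inj_on_subset)
    then show ?thesis using insert.hyps(1) False by (simp add: H_k H_j)
  qed
qed

lemma decomposition_separated: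
  assumes "separated T \<omega>" "0 < T" "F \<in> borel_measurable (FN T)"
  shows "F \<omega> = F (empty_config T) + (\<integral>p. op_H p F \<omega> \<partial>\<omega>)"
proof -
  obtain J x where J: "finite J" "x \<in> J \<rightarrow> space (phase T)" "\<omega> = cfg T J x" "inj_on (\<lambda>j. fst (x j)) J"
    using assms(1,2) by (rule separated_cases)
  have "\<omega> \<in> configs T" using assms(1) by (simp add: separated_def)
  then have "(\<lambda>p. op_H p F \<omega>) \<in> borel_measurable (phase T)"
    by (intro predictable_integrand_measurable op_H_predictable assms(3))
  then have "(\<integral>p. op_H p F \<omega> \<partial>\<omega>) = (\<Sum>j\<in>J. op_H (x j) F \<omega>)"
    using integral_cfg[OF J(1,2)] by (simp add: J(3))
  then show ?thesis using telescope_cfg[OF J(1,2,4), of F] by (simp add: J(3))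
qed

section \<open>Pathwise consequences of predictability\<close>

lemma sigma_sets_indistinguishable:
  assumes "B \<in> sigma_sets \<Omega> \<G>" "a \<in> \<Omega>" "b \<in> \<Omega>" "\<And>g. g \<in> \<G> \<Longrightarrow> a \<in> g \<longleftrightarrow> b \<in> g"
  shows "a \<in> B \<longleftrightarrow> b \<in> B"
  using assms(1) by induction (use assms in auto)

text \<open>Singletons are Borel, so a measurable real function cannot tell apart two points that no
  measurable set separates. This turns measurability for the past into equality of values.\<close>

lemma measurable_indistinguishable:
  fixes f :: "'b \<Rightarrow> real"
  assumes "f \<in> borel_measurable M" "a \<in> space M" "b \<in> space M" "\<And>B. B \<in> sets M \<Longrightarrow> a \<in> B \<longleftrightarrow> b \<in> B"
  shows "f a = f b"
proof -
  have "f -` {f a} \<inter> space M \<in> sets M" by (intro measurable_sets[OF assms(1)] borel_closed) simp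
  from assms(4)[OF this] show ?thesis using assms(2,3) by simp
qed

context
  fixes T t :: real and \<omega> \<omega>' :: "(real \<times> 'a::polish_space) measure"
  assumes configs: "\<omega> \<in> configs T" "\<omega>' \<in> configs T"
    and t: "0 < t" "t \<le> T"
    and agree: "\<And>E. E \<in> sets (phase T) \<Longrightarrow> E \<subseteq> {..<t} \<times> UNIV \<Longrightarrow> emeasure \<omega> E = emeasure \<omega>' E"
begin

text \<open>\<open>FN_upto T s\<close> also counts the points at time \<open>s\<close>, so agreement
  strictly before \<open>t\<close> determines it only for \<open>s < t\<close>.\<close>

lemma FN_upto_agree:
  assumes f: "f \<in> borel_measurable (FN_upto T s)" and s: "s < t"
  shows "(f \<omega> :: real) = f \<omega>'"
proof (rule measurable_indistinguishable[OF f])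
  fix B :: "(real \<times> 'a) measure set" assume "B \<in> sets (FN_upto T s)"
  then have "B \<in> sigma_sets (configs T) {{\<omega>\<in>configs T. emeasure \<omega> (A \<times> B) \<in> U} | A (B :: 'a set) U.
        A \<times> B \<in> sets (phase T) \<and> A \<subseteq> {0..s} \<and> U \<in> sets borel}"
    unfolding FN_upto_def by (subst (asm) sets_measure_of) auto
  then show "\<omega> \<in> B \<longleftrightarrow> \<omega>' \<in> B"
  proof (rule sigma_sets_indistinguishable)
    fix g assume "g \<in> {{\<omega>\<in>configs T. emeasure \<omega> (A \<times> B) \<in> U} | A (B :: 'a set) U.
        A \<times> B \<in> sets (phase T) \<and> A \<subseteq> {0..s} \<and> U \<in> sets borel}"
    then obtain A and B :: "'a set" and U where g: "g = {\<omega>\<in>configs T. emeasure \<omega> (A \<times> B) \<in> U}"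
      "A \<times> B \<in> sets (phase T)" "A \<subseteq> {0..s}" by blast
    have "A \<times> B \<subseteq> {..<t} \<times> UNIV" using g(3) s by auto
    then have "emeasure \<omega> (A \<times> B) = emeasure \<omega>' (A \<times> B)" by (rule agree[OF g(2)])
    then show "\<omega> \<in> g \<longleftrightarrow> \<omega>' \<in> g" using configs by (simp add: g(1))
  qed (use configs in auto)
qed (use configs in simp_all)

text \<open>Before \<open>t\<close> adaptedness decides. At \<open>t\<close> itself both values are
  left limits of paths that coincide on the times from 0 to \<open>t\<close>, which is where
  \<open>0 < t\<close> enters.\<close>

lemma left_cont_adapted_agree:
  assumes Y: "left_cont_adapted T Y" and s: "0 \<le> s" "s \<le> t"
  shows "Y s \<omega> = Y s \<omega>'"
proof -
  have before: "Y u \<omega> = Y u \<omega>'" if "0 \<le> u" "u < t" for u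
  proof (rule FN_upto_agree)
    show "Y u \<in> borel_measurable (FN_upto T u)" using Y that t by (simp add: left_cont_adapted_def)
  qed (rule that(2))
  show ?thesis
  proof (cases "s < t")
    case True
    then show ?thesis using s by (intro before)
  next
    case False
    then have "s = t" using s by simp
    have lim: "((\<lambda>u. Y u \<eta>) \<longlongrightarrow> Y t \<eta>) (at_left t)" if "\<eta> \<in> configs T" for \<eta>
      using Y t that by (simp add: left_cont_adapted_def continuous_within)
    have "eventually (\<lambda>u. Y u \<omega> = Y u \<omega>') (at_left t)"
      using eventually_at_left_real[OF t(1)] by (rule eventually_mono) (simp add: before)
    then have "((\<lambda>u. Y u \<omega>') \<longlongrightarrow> Y t \<omega>) (at_left t)"
      using lim[OF configs(1)] by (rule Lim_transform_eventually[rotated])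
    from tendsto_unique[OF trivial_limit_at_left_real this lim[OF configs(2)]]
    show ?thesis using \<open>s = t\<close> by simp
  qed
qed

text \<open>At time \<open>0\<close> a predictable process may depend on the points at time \<open>0\<close>; this is why the
  horizon is some \<open>t > 0\<close> with \<open>fst p \<le> t\<close> rather than \<open>fst p\<close> itself.\<close>

lemma predictable_agree:
  assumes Z: "(\<lambda>((t, \<omega>), x). Z (t, x) \<omega>) \<in> borel_measurable (predictable T)"
    and p: "0 \<le> fst p" "fst p \<le> t"
  shows "(Z p \<omega> :: real) = Z p \<omega>'"
proof -
  obtain s y where sy: "p = (s, y)" by (cases p)
  have "(\<lambda>z. (z, y)) \<in> measurable (predictable_N T) (predictable T)"
    unfolding predictable_def by (rule measurable_Pair2') simp
  from measurable_compose[OF this Z] have m: "(\<lambda>z. Z (fst z, y) (snd z)) \<in> borel_measurable (predictable_N T)"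
    by (simp add: case_prod_beta')
  have "(\<lambda>z. Z (fst z, y) (snd z)) (s, \<omega>) = (\<lambda>z. Z (fst z, y) (snd z)) (s, \<omega>')"
  proof (rule measurable_indistinguishable[OF m])
    fix B assume "B \<in> sets (predictable_N T :: (real \<times> (real \<times> 'a) measure) measure)"
    then have "B \<in> sigma_sets ({0..T} \<times> configs T)
       {{(t, \<omega>). t \<in> {0..T} \<and> \<omega> \<in> configs T \<and> Y t \<omega> \<in> U} | (Y :: _ \<Rightarrow> (real \<times> 'a) measure \<Rightarrow> _) U.
        left_cont_adapted T Y \<and> U \<in> sets borel}"
      unfolding predictable_N_def by (subst (asm) sets_measure_of) auto
    then show "(s, \<omega>) \<in> B \<longleftrightarrow> (s, \<omega>') \<in> B"
    proof (rule sigma_sets_indistinguishable)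
      fix g assume "g \<in> {{(t, \<omega>). t \<in> {0..T} \<and> \<omega> \<in> configs T \<and> Y t \<omega> \<in> U} | (Y :: _ \<Rightarrow> (real \<times> 'a) measure \<Rightarrow> _) U.
        left_cont_adapted T Y \<and> U \<in> sets borel}"
      then obtain Y :: "real \<Rightarrow> (real \<times> 'a) measure \<Rightarrow> real" and U where
        g: "g = {(t, \<omega>). t \<in> {0..T} \<and> \<omega> \<in> configs T \<and> Y t \<omega> \<in> U}" "left_cont_adapted T Y" by blast
      have "Y s \<omega> = Y s \<omega>'" using p by (intro left_cont_adapted_agree[OF g(2)]) (simp_all add: sy)
      then show "(s, \<omega>) \<in> g \<longleftrightarrow> (s, \<omega>') \<in> g" using configs by (simp add: g(1))
    qed (use configs p t in \<open>simp_all add: sy\<close>)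
  qed (use configs p t in \<open>simp_all add: sy\<close>)
  then show ?thesis by (simp add: sy)
qed

end

text \<open>Both integrals are finite sums. The terms at points before \<open>p\<close> agree by
  predictability, since the two configurations coincide before \<open>fst p\<close>. What remains is
  the term at \<open>p\<close>, and its value is that of the full configuration, which has the same
  past.\<close>

lemma integral_tau_insert_minus_tau:
  fixes Z :: "real \<times> 'a::polish_space \<Rightarrow> (real \<times> 'a) measure \<Rightarrow> real"
  assumes Z: "(\<lambda>((t, \<omega>), x). Z (t, x) \<omega>) \<in> borel_measurable (predictable T)"
    and T: "0 < T" and g: "separated T \<omega>" and p: "p \<in> space (phase T)" "0 < fst p"
  shows "(\<integral>q. Z q (tau_insert p \<omega>) \<partial>tau_insert p \<omega>) - (\<integral>q. Z q (tau (fst p) \<omega>) \<partial>tau (fst p) \<omega>) = Z p \<omega>"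
proof -
  obtain J x where J: "finite J" "x \<in> J \<rightarrow> space (phase T)" "\<omega> = cfg T J x"
    using g T by (rule separated_cases)
  define I where "I = {j\<in>J. fst (x j) < fst p}"
  have t: "0 < fst p" "fst p \<le> T" using p by (auto simp: space_phase)
  \<comment> \<open>A fresh index lets \<open>p\<close> join the listing while the points before it
    keep theirs.\<close>
  obtain k where k: "k \<notin> J" using J(1) ex_new_if_finite infinite_UNIV_nat by blast
  define y where "y = x(k := p)"
  have y: "y \<in> insert k I \<rightarrow> space (phase T)" "y \<in> I \<rightarrow> space (phase T)"
    using J(2) p k by (auto simp: y_def I_def)
  have kI: "k \<notin> I" using k by (simp add: I_def)
  have finI: "finite I" using J(1) by (simp add: I_def)
  have yI: "y j = x j" if "j \<in> I" for j using that kI by (auto simp: y_def)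
  have tau_eq: "tau (fst p) \<omega> = cfg T I y"
  proof -
    have "tau (fst p) \<omega> = cfg T I x" unfolding J(3) I_def using t by (intro tau_cfg[OF J(2)]) simp
    also have "\<dots> = cfg T I y" by (intro cfg_cong) (simp add: yI)
    finally show ?thesis .
  qed
  have tau_insert_eq: "tau_insert p \<omega> = cfg T (insert k I) y"
    using add_dirac_cfg[OF y(1) kI] by (simp add: tau_insert_def tau_eq y_def)
  have \<omega>: "\<omega> \<in> configs T" using g by (simp add: separated_def)
  have tau_c: "tau (fst p) \<omega> \<in> configs T" using \<omega> t by (intro tau_in_configs) simp_all
  have tau_insert_c: "tau_insert p \<omega> \<in> configs T" using \<omega> p(1) by (rule tau_insert_in_configs)
  have before: "E \<inter> ({..<fst p} \<times> UNIV) = E" "p \<notin> E" if "E \<subseteq> {..<fst p} \<times> UNIV" for E :: "(real \<times> 'a) set"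
    using that by (auto simp: mem_Times_iff)
  have Z_tau: "Z q (tau_insert p \<omega>) = Z q (tau (fst p) \<omega>)" if "0 \<le> fst q" "fst q \<le> fst p" for q
    using \<omega> p t before
    by (intro predictable_agree[OF tau_insert_c tau_c t _ Z that]) (simp add: emeasure_tau_insert emeasure_tau)
  have Z_p: "Z p (tau_insert p \<omega>) = Z p \<omega>"
    using \<omega> p t before
    by (intro predictable_agree[OF tau_insert_c \<omega> t _ Z]) (simp_all add: emeasure_tau_insert)
  have "(\<integral>q. Z q (tau_insert p \<omega>) \<partial>tau_insert p \<omega>) = (\<Sum>j\<in>insert k I. Z (y j) (tau_insert p \<omega>))"
    using integral_cfg[OF _ y(1) predictable_integrand_measurable[OF Z tau_insert_c]] finI by (simp add: tau_insert_eq)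
  also have "\<dots> = Z p \<omega> + (\<Sum>j\<in>I. Z (y j) (tau (fst p) \<omega>))"
  proof -
    have "Z (y j) (tau_insert p \<omega>) = Z (y j) (tau (fst p) \<omega>)" if "j \<in> I" for j
      using funcset_mem[OF y(2) that] that by (intro Z_tau) (simp_all add: yI I_def space_phase mem_Times_iff)
    then show ?thesis using finI kI by (simp add: y_def Z_p)
  qed
  also have "(\<Sum>j\<in>I. Z (y j) (tau (fst p) \<omega>)) = (\<integral>q. Z q (tau (fst p) \<omega>) \<partial>tau (fst p) \<omega>)"
    using integral_cfg[OF finI y(2) predictable_integrand_measurable[OF Z tau_c]] by (simp add: tau_eq)
  finally show ?thesis by simp
qed

section \<open>The Clark--Ocone decomposition\<close>

context finite_poisson
begin

text \<open>The triangle inequality splits the increment into two evaluations of |F|. The domination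
  bound for \<open>tau\<close> holds at each fixed point and is integrated over the finite
  intensity; the one for \<open>tau_insert\<close> already includes that integration.\<close>

lemma op_H_LrP:
  assumes F: "F \<in> Lr T P 1"
  shows "(\<lambda>p. op_H p F) \<in> LrP T \<pi> P 1"
proof -
  have FN: "F \<in> borel_measurable (FN T)" and fin: "(\<integral>\<^sup>+\<omega>. ennreal \<bar>F \<omega>\<bar> \<partial>P) < \<infinity>"
    using F by (simp_all add: Lr_def L0_def)
  have FC: "F \<in> borel_measurable (config_space T)" by (rule FN_measurable_config[OF FN])
  have absF: "(\<lambda>\<omega>. ennreal \<bar>F \<omega>\<bar>) \<in> borel_measurable (config_space T)" using FC by measurable
  let ?M = "\<rho> \<Otimes>\<^sub>M P"
  have sets_M: "sets ?M = sets (phase T \<Otimes>\<^sub>M config_space T)" by (intro sets_pair_measure_cong) simp_all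
  have tau_m: "(\<lambda>x. tau (fst (fst x)) (snd x)) \<in> measurable ?M (config_space T)"
    and tau_insert_m: "(\<lambda>x. tau_insert (fst x) (snd x)) \<in> measurable ?M (config_space T)"
    unfolding measurable_cong_sets[OF sets_M refl] by (rule measurable_tau_tau_insert)+
  have tau_F: "(\<lambda>x. ennreal \<bar>F (tau (fst (fst x)) (snd x))\<bar>) \<in> borel_measurable ?M"
    and tau_insert_F: "(\<lambda>x. ennreal \<bar>F (tau_insert (fst x) (snd x))\<bar>) \<in> borel_measurable ?M"
    using measurable_compose[OF tau_m absF] measurable_compose[OF tau_insert_m absF] by simp_all
  have H_eq: "op_H (fst x) F (snd x) = F (tau_insert (fst x) (snd x)) - F (tau (fst (fst x)) (snd x))"
    if "x \<in> space ?M" for x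
    using that by (intro op_H_eq) (auto simp: space_pair_measure)
  have m: "(\<lambda>x. F (tau_insert (fst x) (snd x)) - F (tau (fst (fst x)) (snd x))) \<in> borel_measurable ?M"
    by (intro borel_measurable_diff measurable_compose[OF _ FC] tau_m tau_insert_m)
  have "(\<lambda>x. op_H (fst x) F (snd x)) \<in> borel_measurable ?M"
    by (rule iffD2[OF measurable_cong[OF H_eq] m])
  then have H_m: "(\<lambda>x. ennreal \<bar>op_H (fst x) F (snd x)\<bar>) \<in> borel_measurable ?M" by measurable
  have tau_int: "(\<integral>\<^sup>+x. ennreal \<bar>F (tau (fst (fst x)) (snd x))\<bar> \<partial>?M) < \<infinity>"
  proof -
    have "(\<integral>\<^sup>+x. ennreal \<bar>F (tau (fst (fst x)) (snd x))\<bar> \<partial>?M)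
        = (\<integral>\<^sup>+p. \<integral>\<^sup>+\<omega>. ennreal \<bar>F (tau (fst p) \<omega>)\<bar> \<partial>P \<partial>\<rho>)"
      using P.nn_integral_fst[OF tau_F] by simp
    also have "\<dots> \<le> (\<integral>\<^sup>+p. ennreal (exp R) * (\<integral>\<^sup>+\<omega>. ennreal \<bar>F \<omega>\<bar> \<partial>P) \<partial>\<rho>)"
      using nn_integral_tau_le[OF _ absF] by (intro nn_integral_mono) simp
    also have "\<dots> = ennreal (exp R) * (\<integral>\<^sup>+\<omega>. ennreal \<bar>F \<omega>\<bar> \<partial>P) * emeasure \<rho> (space \<rho>)"
      by (rule nn_integral_const)
    also have "\<dots> < \<infinity>"
      using fin rho_finite by (simp add: ennreal_mult_less_top)
    finally show ?thesis .
  qed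
  have tau_insert_int: "(\<integral>\<^sup>+x. ennreal \<bar>F (tau_insert (fst x) (snd x))\<bar> \<partial>?M) < \<infinity>"
  proof -
    have "(\<integral>\<^sup>+x. ennreal \<bar>F (tau_insert (fst x) (snd x))\<bar> \<partial>?M) \<le> ennreal (exp R) * (\<integral>\<^sup>+\<omega>. ennreal \<bar>F \<omega>\<bar> \<partial>P)"
      by (rule nn_integral_tau_insert_le[OF absF])
    also have "\<dots> < \<infinity>" using fin by (simp add: ennreal_mult_less_top)
    finally show ?thesis .
  qed
  have "(\<integral>\<^sup>+\<omega>. \<integral>\<^sup>+p. ennreal (\<bar>op_H p F \<omega>\<bar> powr 1) \<partial>\<rho> \<partial>P)
      = (\<integral>\<^sup>+x. ennreal \<bar>op_H (fst x) F (snd x)\<bar> \<partial>?M)"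
    using pair.nn_integral_snd[OF H_m] by simp
  also have "\<dots> \<le> (\<integral>\<^sup>+x. ennreal \<bar>F (tau_insert (fst x) (snd x))\<bar> + ennreal \<bar>F (tau (fst (fst x)) (snd x))\<bar> \<partial>?M)"
  proof (rule nn_integral_mono)
    fix x assume "x \<in> space ?M"
    then have "\<bar>op_H (fst x) F (snd x)\<bar> \<le> \<bar>F (tau_insert (fst x) (snd x))\<bar> + \<bar>F (tau (fst (fst x)) (snd x))\<bar>"
      by (simp add: H_eq)
    then show "ennreal \<bar>op_H (fst x) F (snd x)\<bar> \<le> ennreal \<bar>F (tau_insert (fst x) (snd x))\<bar> + ennreal \<bar>F (tau (fst (fst x)) (snd x))\<bar>"
      by (simp flip: ennreal_plus)
  qed
  also have "\<dots> = (\<integral>\<^sup>+x. ennreal \<bar>F (tau_insert (fst x) (snd x))\<bar> \<partial>?M) + (\<integral>\<^sup>+x. ennreal \<bar>F (tau (fst (fst x)) (snd x))\<bar> \<partial>?M)"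
    by (rule nn_integral_add[OF tau_insert_F tau_F])
  also have "\<dots> < \<infinity>" using tau_int tau_insert_int by simp
  finally show ?thesis
    using op_H_predictable[OF FN] by (simp add: LrP_def)
qed

lemma AE_pos_time: "AE p in \<rho>. 0 < fst p"
proof (rule AE_I')
  have "{0} \<times> UNIV \<in> sets (phase T :: (real \<times> 'a) measure)"
    unfolding phase_def using T_pos by (intro pair_measureI) (auto simp: sets_restrict_space_iff)
  then show "{0} \<times> UNIV \<in> null_sets \<rho>"
    using emeasure_strip[of "{0}"] T_pos by (simp add: null_sets_def)
qed (auto simp: space_phase)

text \<open>Applied to the indicator of \<open>N\<close>, the domination bounds vanish. An almost
  sure identity may therefore be used at both configurations entering \<open>op_H\<close>: for
  \<open>tau\<close> at every point, for \<open>tau_insert\<close> at almost every point.\<close>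

lemma AE_tau_notin:
  assumes N: "N \<in> null_sets P"
  shows "AE p in \<rho>. AE \<omega> in P. tau (fst p) \<omega> \<notin> N \<and> tau_insert p \<omega> \<notin> N"
proof -
  have N': "N \<in> sets (config_space T)" "emeasure P N = 0" using N by auto
  have ind: "(indicator N :: _ \<Rightarrow> ennreal) \<in> borel_measurable (config_space T)" using N' by simp
  let ?M = "\<rho> \<Otimes>\<^sub>M P"
  have sets_M: "sets ?M = sets (phase T \<Otimes>\<^sub>M config_space T)" by (intro sets_pair_measure_cong) simp_all
  have tau_insert_m: "(\<lambda>x. tau_insert (fst x) (snd x)) \<in> measurable ?M (config_space T)"
    unfolding measurable_cong_sets[OF sets_M refl] by (rule measurable_tau_tau_insert)
  have P_N: "(\<integral>\<^sup>+\<omega>. indicator N \<omega> \<partial>P) = 0" using N' by simp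
  have "(\<integral>\<^sup>+x. indicator N (tau_insert (fst x) (snd x)) \<partial>?M) = 0"
    using nn_integral_tau_insert_le[OF ind] by (simp add: P_N)
  then have "AE x in ?M. indicator N (tau_insert (fst x) (snd x)) = (0::ennreal)"
    using nn_integral_0_iff_AE[OF measurable_compose[OF tau_insert_m ind]] by simp
  from pair.AE_pair[OF this] have 1: "AE p in \<rho>. AE \<omega> in P. tau_insert p \<omega> \<notin> N"
    by (simp add: indicator_eq_0_iff)
  have 2: "AE \<omega> in P. tau (fst p) \<omega> \<notin> N" if p: "p \<in> space (phase T)" for p :: "real \<times> 'a"
  proof -
    have m: "tau (fst p) \<in> measurable P (config_space T)"
      using measurable_section_tau(1)[OF p] by (simp cong: measurable_cong_sets)
    have "(\<integral>\<^sup>+\<omega>. indicator N (tau (fst p) \<omega>) \<partial>P) = 0"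
      using nn_integral_tau_le[OF p ind] by (simp add: P_N)
    then have "AE \<omega> in P. indicator N (tau (fst p) \<omega>) = (0::ennreal)"
      using nn_integral_0_iff_AE[OF measurable_compose[OF m ind]] by simp
    then show ?thesis by (simp add: indicator_eq_0_iff)
  qed
  show ?thesis
    using 1 AE_space
  proof eventually_elim
    case (elim p)
    then have "AE \<omega> in P. tau (fst p) \<omega> \<notin> N" by (intro 2) simp
    with elim(1) show ?case by eventually_elim simp
  qed
qed

lemma decomposition_unique:
  assumes F: "F \<in> Lr T P 1" and Z: "Z \<in> LrP T \<pi> P 1"
    and eq: "AE \<omega> in P. F \<omega> = c + (\<integral>p. Z p \<omega> \<partial>\<omega>)"
  shows "c = F (empty_config T)" and "AE p in \<rho>. AE \<omega> in P. Z p \<omega> = op_H p F \<omega>"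
proof -
  have Zm: "(\<lambda>((t, \<omega>), x). Z (t, x) \<omega>) \<in> borel_measurable (predictable T)"
    using Z by (simp add: LrP_def)
  obtain N where N: "N \<in> null_sets P" and sub: "{\<omega>\<in>space P. \<not> F \<omega> = c + (\<integral>p. Z p \<omega> \<partial>\<omega>)} \<subseteq> N"
    using eq by (auto elim!: AE_E simp: null_sets_def)
  have F_eq: "F \<omega> = c + (\<integral>p. Z p \<omega> \<partial>\<omega>)" if "\<omega> \<in> configs T" "\<omega> \<notin> N" for \<omega>
    using sub that by auto
  \<comment> \<open>The event of no points has probability \<open>exp (- R) > 0\<close>, so it
    cannot be contained in a null set. Evaluating the identity at the empty configuration, where the
    integral vanishes, identifies \<open>c\<close>.\<close>
  have "\<not> void T (space (phase T)) \<subseteq> N"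
  proof
    assume "void T (space (phase T)) \<subseteq> N"
    then have "emeasure P (void T (space (phase T))) \<le> emeasure P N"
      using N by (intro emeasure_mono) auto
    then show False using N emeasure_void[OF sets.top] by (simp add: null_sets_def)
  qed
  then obtain \<omega> where \<omega>: "\<omega> \<in> configs T" "emeasure \<omega> (space (phase T)) = 0" "\<omega> \<notin> N"
    by (auto simp: void_def)
  have "\<omega> = empty_config T"
  proof (rule configs_eqI[OF \<omega>(1)])
    fix E :: "(real \<times> 'a) set" assume "E \<in> sets (phase T)"
    then show "emeasure \<omega> E = emeasure (empty_config T) E"
      using emeasure_mono[OF sets.sets_into_space, of E "phase T" \<omega>] \<omega>(2) sets_configs[OF \<omega>(1)] by simp
  qed simp
  then have \<omega>_cfg: "\<omega> = cfg T {} (\<lambda>_. undefined)" by (simp add: cfg_empty)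
  have "(\<integral>p. Z p \<omega> \<partial>\<omega>) = 0"
    using integral_cfg[of "{}" "\<lambda>_. undefined" T "\<lambda>p. Z p \<omega>"] predictable_integrand_measurable[OF Zm \<omega>(1)]
    by (simp flip: \<omega>_cfg)
  then show "c = F (empty_config T)" using F_eq[OF \<omega>(1,3)] \<open>\<omega> = empty_config T\<close> by simp
  show "AE p in \<rho>. AE \<omega> in P. Z p \<omega> = op_H p F \<omega>"
    using AE_tau_notin[OF N] AE_pos_time AE_space
  proof eventually_elim
    case (elim p)
    then have p: "p \<in> space (phase T)" "0 < fst p" by simp_all
    from elim(1) AE_separated show ?case
    proof eventually_elim
      case (elim \<omega>)
      then have \<omega>: "\<omega> \<in> configs T" by (simp add: separated_def)
      have "tau (fst p) \<omega> \<in> configs T" "tau_insert p \<omega> \<in> configs T"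
        using \<omega> p by (auto intro!: tau_in_configs tau_insert_in_configs)
      \<comment> \<open>Both configurations avoid \<open>N\<close>, so the identity holds at each of
        them and the constant \<open>c\<close> cancels in the difference.\<close>
      then have "op_H p F \<omega> = (\<integral>q. Z q (tau_insert p \<omega>) \<partial>tau_insert p \<omega>) - (\<integral>q. Z q (tau (fst p) \<omega>) \<partial>tau (fst p) \<omega>)"
        using elim(1) by (simp add: op_H_eq[OF \<omega> p(1)] F_eq)
      then show ?case using integral_tau_insert_minus_tau[OF Zm T_pos elim(2) p] by simp
    qed
  qed
qed

end

theorem theorem3p8:
  fixes T :: real
    and \<pi> :: "'a::polish_space measure"
    and P :: "(real \<times> 'a) measure measure"
    and F :: "(real \<times> 'a) measure \<Rightarrow> real"
  assumes "0 < T"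
    and "sets \<pi> = sets borel" and "sigma_finite_measure \<pi>" and "nonatomic \<pi>"
    and "poisson_law T \<pi> P"
    and "emeasure (rho T \<pi>) (space (rho T \<pi>)) < \<infinity>"
    and "F \<in> Lr T P 1"
  shows "(\<lambda>p. op_H p F) \<in> LrP T \<pi> P 1 \<and>
    (AE \<omega> in P. F \<omega> = F (empty_config T) + (\<integral>p. op_H p F \<omega> \<partial>\<omega>)) \<and>
    (\<forall>(c::real) Z. Z \<in> LrP T \<pi> P 1 \<longrightarrow> (AE \<omega> in P. F \<omega> = c + (\<integral>p. Z p \<omega> \<partial>\<omega>)) \<longrightarrow>
       c = F (empty_config T) \<and>
       (AE p in rho T \<pi>. AE \<omega> in P. Z p \<omega> = op_H p F \<omega>))"
proof -
  interpret finite_poisson T \<pi> P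
    by (rule finite_poisson.intro) (use assms in simp_all)
  have F: "F \<in> borel_measurable (FN T)" using assms(7) by (simp add: Lr_def L0_def)
  have "AE \<omega> in P. F \<omega> = F (empty_config T) + (\<integral>p. op_H p F \<omega> \<partial>\<omega>)"
    using AE_separated by (rule eventually_mono) (rule decomposition_separated[OF _ T_pos F])
  then show ?thesis
    using op_H_LrP[OF assms(7)] decomposition_unique[OF assms(7)] by blast
qed

end
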